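(* Let $q\ge 3$ and $D=\tfrac12q(q-1)$. Any real two-step nilpotent Lie algebra of type $(D-1,q)$ is an Einstein nilradical.
   Context: All Lie algebras are real and finite-dimensional. A two-step nilpotent Lie algebra $\mathfrak{n}$ is of type $(p,q)$ if $\dim\mathfrak{n}=p+q$ and $\dim[\mathfrak{n},\mathfrak{n}]=p$; necessarily $1\le p\le D$, so type $(D-1,q)$ occurs only for $q\ge3$. A metric solvable Lie algebra $(\mathfrak{g},\langle\cdot,\cdot\rangle)$ is Einstein if the corresponding left-invariant Riemannian metric on the simply connected Lie group of $\mathfrak{g}$ is Einstein; throughout, $\mathfrak g$ is nonunimodular and the scalar curvature is strictly negative. A nilpotent Lie algebra is called an Einstein nilradical if it is the nilradical of some Einstein metric solvable Lie algebra. *)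

theory Defs
  imports "HOL-Analysis.Analysis" "HOL-Analysis.Finite_Function_Topology"
begin

text \<open>
  A real finite-dimensional Lie algebra is a finite-dimensional subspace \<open>V\<close> of a real vector
  space together with a bracket \<open>br\<close>. Brackets, inner products and connections are total
  functions, of which only the values on \<open>V\<close> matter.
\<close>

definition linear_map_on ::
    "'a::real_vector set \<Rightarrow> ('a \<Rightarrow> 'b::real_vector) \<Rightarrow> bool" where
  "linear_map_on V f \<longleftrightarrow>
     (\<forall>x\<in>V. \<forall>y\<in>V. f (x + y) = f x + f y) \<and> (\<forall>c. \<forall>x\<in>V. f (c *\<^sub>R x) = c *\<^sub>R f x)"

definition bilinear_map_on ::
    "'a::real_vector set \<Rightarrow> ('a \<Rightarrow> 'a \<Rightarrow> 'b::real_vector) \<Rightarrow> bool" where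
  "bilinear_map_on V f \<longleftrightarrow>
     (\<forall>x\<in>V. linear_map_on V (f x)) \<and> (\<forall>y\<in>V. linear_map_on V (\<lambda>x. f x y))"

definition basis_of :: "'a::real_vector set \<Rightarrow> 'a set \<Rightarrow> bool" where
  "basis_of V B \<longleftrightarrow> independent B \<and> span B = V"

definition trace_on :: "'a::real_vector set \<Rightarrow> ('a \<Rightarrow> 'a) \<Rightarrow> real" where
  "trace_on V f = (let B = SOME B. basis_of V B in \<Sum>b\<in>B. representation B (f b) b)"

locale lie_algebra =
  fixes V :: "'a::real_vector set" and br :: "'a \<Rightarrow> 'a \<Rightarrow> 'a"
  assumes finite_dimensional: "\<exists>B. finite B \<and> span B = V"
    and bracket_closed: "\<lbrakk>x \<in> V; y \<in> V\<rbrakk> \<Longrightarrow> br x y \<in> V"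
    and bracket_bilinear: "bilinear_map_on V br"
    and bracket_alternating: "x \<in> V \<Longrightarrow> br x x = 0"
    and jacobi: "\<lbrakk>x \<in> V; y \<in> V; z \<in> V\<rbrakk> \<Longrightarrow>
      br x (br y z) + br y (br z x) + br z (br x y) = 0"

definition bracket_span ::
    "('a::real_vector \<Rightarrow> 'a \<Rightarrow> 'a) \<Rightarrow> 'a set \<Rightarrow> 'a set \<Rightarrow> 'a set" where
  "bracket_span br A B = span {br x y | x y. x \<in> A \<and> y \<in> B}"

fun lower_central_series ::
    "'a::real_vector set \<Rightarrow> ('a \<Rightarrow> 'a \<Rightarrow> 'a) \<Rightarrow> nat \<Rightarrow> 'a set" where
  "lower_central_series V br 0 = V"
| "lower_central_series V br (Suc k) = bracket_span br V (lower_central_series V br k)"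

fun derived_series ::
    "'a::real_vector set \<Rightarrow> ('a \<Rightarrow> 'a \<Rightarrow> 'a) \<Rightarrow> nat \<Rightarrow> 'a set" where
  "derived_series V br 0 = V"
| "derived_series V br (Suc k) =
     bracket_span br (derived_series V br k) (derived_series V br k)"

definition nilpotent_lie :: "'a::real_vector set \<Rightarrow> ('a \<Rightarrow> 'a \<Rightarrow> 'a) \<Rightarrow> bool" where
  "nilpotent_lie V br \<longleftrightarrow> (\<exists>k. lower_central_series V br k = {0})"

definition solvable_lie :: "'a::real_vector set \<Rightarrow> ('a \<Rightarrow> 'a \<Rightarrow> 'a) \<Rightarrow> bool" where
  "solvable_lie V br \<longleftrightarrow> (\<exists>k. derived_series V br k = {0})"

definition two_step_nilpotent :: "'a::real_vector set \<Rightarrow> ('a \<Rightarrow> 'a \<Rightarrow> 'a) \<Rightarrow> bool" where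
  "two_step_nilpotent V br \<longleftrightarrow>
     bracket_span br V V \<noteq> {0} \<and> bracket_span br V (bracket_span br V V) = {0}"

definition two_step_of_type ::
    "'a::real_vector set \<Rightarrow> ('a \<Rightarrow> 'a \<Rightarrow> 'a) \<Rightarrow> nat \<Rightarrow> nat \<Rightarrow> bool" where
  "two_step_of_type V br p q \<longleftrightarrow>
     two_step_nilpotent V br \<and> dim V = p + q \<and> dim (bracket_span br V V) = p"

definition lie_ideal :: "'a::real_vector set \<Rightarrow> ('a \<Rightarrow> 'a \<Rightarrow> 'a) \<Rightarrow> 'a set \<Rightarrow> bool" where
  "lie_ideal V br I \<longleftrightarrow> subspace I \<and> I \<subseteq> V \<and> (\<forall>x\<in>V. \<forall>y\<in>I. br x y \<in> I)"

text \<open>The nilradical is the largest nilpotent ideal.\<close>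

definition is_nilradical :: "'a::real_vector set \<Rightarrow> ('a \<Rightarrow> 'a \<Rightarrow> 'a) \<Rightarrow> 'a set \<Rightarrow> bool" where
  "is_nilradical V br N \<longleftrightarrow>
     lie_ideal V br N \<and> nilpotent_lie N br \<and>
     (\<forall>I. lie_ideal V br I \<and> nilpotent_lie I br \<longrightarrow> I \<subseteq> N)"

definition lie_isomorphic ::
    "'a::real_vector set \<Rightarrow> ('a \<Rightarrow> 'a \<Rightarrow> 'a) \<Rightarrow> 'b::real_vector set \<Rightarrow> ('b \<Rightarrow> 'b \<Rightarrow> 'b) \<Rightarrow> bool" where
  "lie_isomorphic V br W br' \<longleftrightarrow>
     (\<exists>f. bij_betw f V W \<and> linear_map_on V f \<and> (\<forall>x\<in>V. \<forall>y\<in>V. f (br x y) = br' (f x) (f y)))"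

definition unimodular :: "'a::real_vector set \<Rightarrow> ('a \<Rightarrow> 'a \<Rightarrow> 'a) \<Rightarrow> bool" where
  "unimodular V br \<longleftrightarrow> (\<forall>x\<in>V. trace_on V (br x) = 0)"

definition inner_product_on :: "'a::real_vector set \<Rightarrow> ('a \<Rightarrow> 'a \<Rightarrow> real) \<Rightarrow> bool" where
  "inner_product_on V ip \<longleftrightarrow>
     bilinear_map_on V ip \<and> (\<forall>x\<in>V. \<forall>y\<in>V. ip x y = ip y x) \<and> (\<forall>x\<in>V. x \<noteq> 0 \<longrightarrow> ip x x > 0)"

definition orthonormal_basis_of ::
    "'a::real_vector set \<Rightarrow> ('a \<Rightarrow> 'a \<Rightarrow> real) \<Rightarrow> 'a set \<Rightarrow> bool" where
  "orthonormal_basis_of V ip E \<longleftrightarrow>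
     basis_of V E \<and> (\<forall>x\<in>E. \<forall>y\<in>E. ip x y = (if x = y then 1 else 0))"

text \<open>
  An inner product on a Lie algebra induces a left-invariant Riemannian metric on the simply
  connected Lie group. Its Levi-Civita connection and curvature are left-invariant, so they are
  given by their values on left-invariant vector fields, that is, on elements of the Lie algebra.
  Since the inner product of two left-invariant fields is a constant function, compatibility of
  the connection with the metric says that each \<open>nabla x\<close> is skew-symmetric.
\<close>

definition levi_civita ::
    "'a::real_vector set \<Rightarrow> ('a \<Rightarrow> 'a \<Rightarrow> 'a) \<Rightarrow> ('a \<Rightarrow> 'a \<Rightarrow> real) \<Rightarrow> ('a \<Rightarrow> 'a \<Rightarrow> 'a) \<Rightarrow> bool" where
  "levi_civita V br ip nabla \<longleftrightarrow>
     (\<forall>x\<in>V. \<forall>y\<in>V. nabla x y \<in> V) \<and>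
     bilinear_map_on V nabla \<and>
     (\<forall>x\<in>V. \<forall>y\<in>V. nabla x y - nabla y x = br x y) \<and>
     (\<forall>x\<in>V. \<forall>y\<in>V. \<forall>z\<in>V. ip (nabla x y) z + ip y (nabla x z) = 0)"

lemma koszul_formula:
  assumes "lie_algebra V br" "inner_product_on V ip" "levi_civita V br ip nabla"
    and "x \<in> V" "y \<in> V" "z \<in> V"
  shows "2 * ip (nabla x y) z = ip (br x y) z - ip (br y z) x + ip (br z x) y"
proof -
  have V: "subspace V"
    using lie_algebra.finite_dimensional[OF assms(1)] by force
  have diff: "ip (a - b) c = ip a c - ip b c" if "a \<in> V" "b \<in> V" "c \<in> V" for a b c
  proof -
    have "linear_map_on V (\<lambda>x. ip x c)"
      using assms(2) that by (simp add: inner_product_on_def bilinear_map_on_def)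
    then have "ip (a - b + b) c = ip (a - b) c + ip b c"
      using that subspace_diff[OF V, of a b] unfolding linear_map_on_def by blast
    then show ?thesis by simp
  qed
  have nabla_closed: "nabla a b \<in> V" if "a \<in> V" "b \<in> V" for a b
    using assms(3) that by (auto simp: levi_civita_def)
  have br: "ip (br a b) c = ip (nabla a b) c - ip (nabla b a) c"
    if "a \<in> V" "b \<in> V" "c \<in> V" for a b c
  proof -
    have "br a b = nabla a b - nabla b a"
      using assms(3) that by (auto simp: levi_civita_def)
    then show ?thesis using diff nabla_closed that by simp
  qed
  have skew: "ip (nabla a b) c = - ip (nabla a c) b" if "a \<in> V" "b \<in> V" "c \<in> V" for a b c
  proof -
    have "ip (nabla a b) c + ip b (nabla a c) = 0"
      using assms(3) that by (auto simp: levi_civita_def)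
    moreover have "ip b (nabla a c) = ip (nabla a c) b"
      using assms(2) that nabla_closed by (auto simp: inner_product_on_def)
    ultimately show ?thesis by simp
  qed
  show ?thesis
    using br skew[of x y z] skew[of y x z] skew[of z x y] assms(4-6) by simp
qed

definition curvature ::
    "('a::real_vector \<Rightarrow> 'a \<Rightarrow> 'a) \<Rightarrow> ('a \<Rightarrow> 'a \<Rightarrow> 'a) \<Rightarrow> 'a \<Rightarrow> 'a \<Rightarrow> 'a \<Rightarrow> 'a" where
  "curvature br nabla x y z = nabla x (nabla y z) - nabla y (nabla x z) - nabla (br x y) z"

definition ricci ::
    "'a::real_vector set \<Rightarrow> ('a \<Rightarrow> 'a \<Rightarrow> 'a) \<Rightarrow> ('a \<Rightarrow> 'a \<Rightarrow> 'a) \<Rightarrow> 'a \<Rightarrow> 'a \<Rightarrow> real" where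
  "ricci V br nabla y z = trace_on V (\<lambda>x. curvature br nabla x y z)"

definition scalar_curvature ::
    "'a::real_vector set \<Rightarrow> ('a \<Rightarrow> 'a \<Rightarrow> 'a) \<Rightarrow> ('a \<Rightarrow> 'a \<Rightarrow> real) \<Rightarrow> ('a \<Rightarrow> 'a \<Rightarrow> 'a) \<Rightarrow> real" where
  "scalar_curvature V br ip nabla =
     (\<Sum>e\<in>(SOME E. orthonormal_basis_of V ip E). ricci V br nabla e e)"

text \<open>
  The scalar curvature is required to be negative and the Lie algebra to be nonunimodular.
  By the Koszul formula, \<open>nabla\<close> is uniquely determined on \<open>V\<close>.
\<close>

definition einstein_metric_solvable ::
    "'a::real_vector set \<Rightarrow> ('a \<Rightarrow> 'a \<Rightarrow> 'a) \<Rightarrow> ('a \<Rightarrow> 'a \<Rightarrow> real) \<Rightarrow> bool" where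
  "einstein_metric_solvable V br ip \<longleftrightarrow>
     lie_algebra V br \<and> solvable_lie V br \<and> \<not> unimodular V br \<and> inner_product_on V ip \<and>
     (\<exists>nabla. levi_civita V br ip nabla \<and>
        (\<exists>c. \<forall>x\<in>V. \<forall>y\<in>V. ricci V br nabla x y = c * ip x y) \<and>
        scalar_curvature V br ip nabla < 0)"

text \<open>
  The ambient metric Lie algebra ranges over the finite-dimensional subspaces of the space
  \<^typ>\<open>nat \<Rightarrow>\<^sub>0 real\<close> of finitely supported sequences. As this space is infinite-dimensional,
  every finite-dimensional real Lie algebra is isomorphic to one of this form.
\<close>

definition einstein_nilradical :: "'a::real_vector set \<Rightarrow> ('a \<Rightarrow> 'a \<Rightarrow> 'a) \<Rightarrow> bool" where
  "einstein_nilradical V br \<longleftrightarrow>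
     (\<exists>(G :: (nat \<Rightarrow>\<^sub>0 real) set) brG ip N.
        einstein_metric_solvable G brG ip \<and> is_nilradical G brG N \<and> lie_isomorphic V br N brG)"

end

theory Submission
  imports Defs
begin

text \<open>
  Let \<open>n\<close> be of type \<open>(D - 1, q)\<close> and choose a complement \<open>v\<close> of \<open>[n, n]\<close>, so \<open>dim v = q\<close>. The bracket
  maps the \<open>D\<close>-dimensional space of bivectors of \<open>v\<close> onto \<open>[n, n]\<close>, so its kernel is a line, and the
  bivector spanning this line determines \<open>n\<close>. Every nonzero bivector has a Darboux normal form
  (\<open>darboux_bivector\<close>): there are a basis \<open>e\<close> of \<open>v\<close> and a skew matrix \<open>J\<close>, supported on a nonempty set \<open>S\<close>
  of indices and with orthonormal rows there, such that the only relation between the brackets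
  \<open>[e i, e j]\<close> is \<open>\<Sum> J i j [e i, e j] = 0\<close>. Hence \<open>n\<close> is isomorphic to \<open>\<real>\<^sup>q \<oplus> J\<^sup>\<bottom>\<close>, where \<open>J\<^sup>\<bottom>\<close> is the
  orthogonal complement of \<open>J\<close> in the skew \<open>q \<times> q\<close> matrices and \<open>[v, w]\<close> is the projection to \<open>J\<^sup>\<bottom>\<close> of
  the matrix with entries \<open>\<sigma> i j (v i w j - v j w i)\<close>; the symmetric positive weights \<open>\<sigma> i j\<close> may be chosen
  freely as long as they are constant on \<open>S \<times> S\<close> (\<open>lie_isomorphic_N\<close>).

  This freedom is used to make \<open>n\<close> a nilsoliton, that is, to achieve \<open>Ric = -1 + D\<close> with a derivation \<open>D\<close>.
  Let \<open>D\<close> act by \<open>d i\<close> on the \<open>i\<close>-th coordinate of \<open>v\<close> and by \<open>d i + d j\<close> on the entry \<open>(i, j)\<close>, with \<open>d = a\<close> on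
  \<open>S\<close> and \<open>d = b\<close> off \<open>S\<close>; then \<open>J\<close> is an eigenvector, so \<open>D\<close> descends to \<open>J\<^sup>\<bottom>\<close> and is a derivation. On
  the centre the soliton equation says \<open>\<sigma> i j ^ 2 = 2 (d i + d j - 1)\<close>. On \<open>v\<close> the Ricci operator is diagonal
  because \<open>J\<close> is orthonormal on \<open>S\<close>, and the equation becomes two linear equations for \<open>a\<close> and \<open>b\<close>. Their
  solution has \<open>d i + d j > 1\<close> wherever a weight \<open>\<sigma> i j\<close> is needed (\<open>soliton_parameters\<close>); the hypothesis
  \<open>q \<ge> 3\<close> enters here.

  A nilsoliton extends to an Einstein algebra by one dimension: adjoin a unit vector \<open>H\<close> acting by \<open>\<tau> D\<close>
  with \<open>\<tau>\<^sup>2 tr D = 1\<close>. The Ricci form is computed from the Levi-Civita connection (\<open>ricci_G\<close>) and equals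
  minus the inner product; in the direction \<open>H\<close> this needs \<open>tr D\<^sup>2 = tr D\<close>, which reflects that the Ricci
  operator of \<open>n\<close> is orthogonal to every derivation (\<open>trace_der_eq_trace_der_sq\<close>). Since \<open>D\<close> is positive, an
  element outside \<open>n\<close> does not act nilpotently, so \<open>n\<close> is the nilradical (\<open>nilradical_N\<close>).
\<close>

section \<open>Linear algebra on subspaces\<close>

lemma linear_map_on_sum:
  assumes V: "subspace V" and f: "linear_map_on V f" and g: "\<And>i. i \<in> A \<Longrightarrow> g i \<in> V"
  shows "f (\<Sum>i\<in>A. c i *\<^sub>R g i) = (\<Sum>i\<in>A. c i *\<^sub>R f (g i))"
  using g
proof (induction A rule: infinite_finite_induct)
  case (insert a A)
  have "(\<Sum>i\<in>A. c i *\<^sub>R g i) \<in> V" "c a *\<^sub>R g a \<in> V"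
    using insert.prems V by (auto intro!: subspace_sum subspace_scale)
  then show ?case using insert f by (simp add: linear_map_on_def)
next
  case empty
  have "f (0 *\<^sub>R 0) = 0 *\<^sub>R f 0" using f subspace_0[OF V] unfolding linear_map_on_def by blast
  then show ?case by simp
next
  case (infinite A)
  have "f (0 *\<^sub>R 0) = 0 *\<^sub>R f 0" using f subspace_0[OF V] unfolding linear_map_on_def by blast
  then show ?case using infinite by simp
qed

lemma bilinear_map_on_sum:
  assumes V: "subspace V" and f: "bilinear_map_on V f"
    and g: "\<And>i. i \<in> A \<Longrightarrow> g i \<in> V" and h: "\<And>j. j \<in> B \<Longrightarrow> h j \<in> V"
  shows "f (\<Sum>i\<in>A. c i *\<^sub>R g i) (\<Sum>j\<in>B. d j *\<^sub>R h j)
    = (\<Sum>i\<in>A. \<Sum>j\<in>B. (c i * d j) *\<^sub>R f (g i) (h j))"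
proof -
  have s: "(\<Sum>j\<in>B. d j *\<^sub>R h j) \<in> V"
    using h V by (auto intro!: subspace_sum subspace_scale)
  have "f (\<Sum>i\<in>A. c i *\<^sub>R g i) (\<Sum>j\<in>B. d j *\<^sub>R h j)
      = (\<Sum>i\<in>A. c i *\<^sub>R f (g i) (\<Sum>j\<in>B. d j *\<^sub>R h j))"
    using linear_map_on_sum[OF V, of "\<lambda>x. f x (\<Sum>j\<in>B. d j *\<^sub>R h j)"] f g s
    unfolding bilinear_map_on_def by blast
  also have "\<dots> = (\<Sum>i\<in>A. c i *\<^sub>R (\<Sum>j\<in>B. d j *\<^sub>R f (g i) (h j)))"
    using f g h linear_map_on_sum[OF V, of "f _" B h d] unfolding bilinear_map_on_def
    by (intro sum.cong refl) simp
  finally show ?thesis by (simp add: scaleR_sum_right)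
qed

lemma finite_basis_of:
  assumes "finite B" "span B = V"
  shows "\<exists>B. basis_of V B" and "basis_of V C \<Longrightarrow> finite C"
proof -
  obtain B' where "B' \<subseteq> B" "independent B'" "B \<subseteq> span B'"
    using maximal_independent_subset[of B] by blast
  then have "span B' = V"
    using assms(2) by (metis span_mono span_span subset_antisym)
  then show "\<exists>B. basis_of V B" using \<open>independent B'\<close> by (auto simp: basis_of_def)
  show "finite C" if "basis_of V C"
    using that assms independent_span_bound[of B C] span_superset[of C]
    by (auto simp: basis_of_def)
qed

text \<open>
  A frame takes the place of a basis, because \<open>J\<^sup>\<bottom>\<close> has no convenient orthonormal
  basis, whereas the projections of the elementary skew matrices give a frame with the coordinate
  functionals as coefficients.
\<close>

lemma trace_on_frame:
  fixes phi :: "'s \<Rightarrow> 'a::real_vector \<Rightarrow> real"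
  assumes fin: "\<exists>B. finite B \<and> span B = V"
    and f: "linear_map_on V f" "\<And>x. x \<in> V \<Longrightarrow> f x \<in> V"
    and w: "\<And>s. s \<in> S \<Longrightarrow> w s \<in> V" and phi: "\<And>s. s \<in> S \<Longrightarrow> linear_map_on V (phi s)"
    and frame: "\<And>x. x \<in> V \<Longrightarrow> x = (\<Sum>s\<in>S. phi s x *\<^sub>R w s)"
  shows "trace_on V f = (\<Sum>s\<in>S. phi s (f (w s)))"
proof -
  have V: "subspace V" using fin by force
  define B where "B = (SOME B. basis_of V B)"
  have "basis_of V B" unfolding B_def using fin finite_basis_of(1) by (metis someI_ex)
  then have B: "independent B" "span B = V" "finite B"
    using fin finite_basis_of(2) by (auto simp: basis_of_def)
  have BV: "b \<in> V" if "b \<in> B" for b using that B(2) span_base by auto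
  have rep: "representation B (f b) b = (\<Sum>s\<in>S. phi s b * representation B (f (w s)) b)"
    if "b \<in> B" for b
  proof -
    have "f b = (\<Sum>s\<in>S. phi s b *\<^sub>R f (w s))"
      using linear_map_on_sum[OF V f(1), where A = S and g = w and c = "\<lambda>s. phi s b"] w frame[OF BV[OF that]] by auto
    then show ?thesis
      using B f(2) w V by (simp add: real_vector.representation_sum real_vector.representation_scale
          subspace_scale)
  qed
  have "phi s (f (w s)) = (\<Sum>b\<in>B. representation B (f (w s)) b * phi s b)" if s: "s \<in> S" for s
  proof -
    have "f (w s) = (\<Sum>b\<in>B. representation B (f (w s)) b *\<^sub>R b)"
      using real_vector.sum_representation_eq[OF B(1) _ B(3) order_refl, of "f (w s)"] f(2) w s B(2)
      by simp
    then have "phi s (f (w s)) = phi s (\<Sum>b\<in>B. representation B (f (w s)) b *\<^sub>R b)" by simp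
    also have "\<dots> = (\<Sum>b\<in>B. representation B (f (w s)) b *\<^sub>R phi s b)"
      by (rule linear_map_on_sum[OF V phi[OF s] BV])
    finally show ?thesis by simp
  qed
  then have "(\<Sum>s\<in>S. phi s (f (w s))) = (\<Sum>b\<in>B. \<Sum>s\<in>S. phi s b * representation B (f (w s)) b)"
    by (subst sum.swap) (simp add: mult.commute)
  then show ?thesis using rep by (simp add: trace_on_def flip: B_def)
qed

text \<open>
  Gram-Schmidt. It is needed because the scalar curvature sums over an arbitrarily chosen orthonormal
  basis, so its value is only determined once such a basis exists.
\<close>

lemma orthonormal_basis_exists:
  assumes "finite B" "span B = V" "inner_product_on V ip"
  shows "\<exists>E. finite E \<and> orthonormal_basis_of V ip E"
proof -
  have V: "subspace V" using assms(2) by force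
  have bil: "bilinear_map_on V ip" and sym: "\<And>x y. x \<in> V \<Longrightarrow> y \<in> V \<Longrightarrow> ip x y = ip y x"
    and pos: "\<And>x. x \<in> V \<Longrightarrow> x \<noteq> 0 \<Longrightarrow> ip x x > 0"
    using assms(3) by (auto simp: inner_product_on_def)
  have lin: "linear_map_on V (\<lambda>x. ip x y)" if "y \<in> V" for y
    using bil that by (simp add: bilinear_map_on_def)
  have "\<exists>E. finite E \<and> E \<subseteq> V \<and> span E = span B' \<and> (\<forall>x\<in>E. \<forall>y\<in>E. ip x y = (if x = y then 1 else 0))"
    if "finite B'" "B' \<subseteq> V" for B'
    using that
  proof (induction B')
    case empty
    show ?case by (intro exI[of _ "{}"]) auto
  next
    case (insert b B')
    then obtain E where E: "finite E" "E \<subseteq> V" "span E = span B'"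
      "\<And>x y. x \<in> E \<Longrightarrow> y \<in> E \<Longrightarrow> ip x y = (if x = y then 1 else 0)" by auto
    define p where "p = (\<Sum>e\<in>E. ip b e *\<^sub>R e)"
    define u where "u = b - p"
    have b: "b \<in> V" using insert by auto
    have p: "p \<in> span E" unfolding p_def by (intro span_sum span_scale span_base)
    then have pV: "p \<in> V" using E(2) V by (meson span_minimal subsetD)
    then have u: "u \<in> V" using b V by (simp add: u_def subspace_diff)
    have span_u: "span (insert u E) = span (insert b B')"
    proof -
      have "span (insert u E) = span (insert b E)"
      proof (subst span_eq, intro conjI subsetI)
        have p': "p \<in> span (insert y E)" for y using p span_mono[of E "insert y E"] by auto
        show "x \<in> span (insert b E)" if "x \<in> insert u E" for x
          using that p'[of b] by (auto simp: u_def intro!: span_diff intro: span_base)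
        have "b = u + p" by (simp add: u_def)
        then show "x \<in> span (insert u E)" if "x \<in> insert b E" for x
          using that p'[of u] span_add[OF span_base[of u "insert u E"] p'[of u]]
          by (auto intro: span_base)
      qed
      then show ?thesis using E(3) by (simp add: span_insert)
    qed
    have orth: "ip u e = 0" if e: "e \<in> E" for e
    proof -
      have eV: "e \<in> V" using e E by auto
      have "ip b e = ip (u + p) e" by (simp add: u_def)
      also have "\<dots> = ip u e + ip p e"
        using lin[OF eV] u pV unfolding linear_map_on_def by blast
      also have "ip p e = (\<Sum>e'\<in>E. ip b e' *\<^sub>R ip e' e)"
        unfolding p_def using E(2) by (intro linear_map_on_sum[OF V lin[OF eV]]) auto
      also have "\<dots> = (\<Sum>e'\<in>E. if e' = e then ip b e' else 0)"
        using E(4) e by (intro sum.cong) auto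
      also have "\<dots> = ip b e" using e E(1) by simp
      finally show ?thesis by simp
    qed
    show ?case
    proof (cases "u = 0")
      case True
      then have "span (insert b B') = span E" using span_u by simp
      then show ?thesis using E by (intro exI[of _ E]) auto
    next
      case False
      define n where "n = (1 / sqrt (ip u u)) *\<^sub>R u"
      have un: "ip u u > 0" using pos[OF u False] .
      have nV: "n \<in> V" using u V by (simp add: n_def subspace_scale)
      have sc: "ip n y = (1 / sqrt (ip u u)) * ip u y" if "y \<in> V" for y
        using lin[OF that] u unfolding n_def linear_map_on_def by simp
      have nn: "ip n n = 1"
        using sc[OF nV] sc[OF u] sym[OF u nV] un by (simp add: field_simps)
      have ne: "ip n e = 0" "ip e n = 0" if "e \<in> E" for e
      proof -
        show "ip n e = 0" using that E(2) sc orth by auto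
        then show "ip e n = 0" using that E(2) sym[OF nV, of e] by auto
      qed
      have "span (insert n E) = span (insert u E)"
      proof (subst span_eq, intro conjI subsetI)
        show "x \<in> span (insert u E)" if "x \<in> insert n E" for x
          using that span_scale[OF span_base[of u "insert u E"]] by (auto simp: n_def intro: span_base)
        have "u = sqrt (ip u u) *\<^sub>R n" using un by (simp add: n_def)
        then show "x \<in> span (insert n E)" if "x \<in> insert u E" for x
          using that span_scale[OF span_base[of n "insert n E"]]
          by (metis insertE insertI1 insertI2 span_base)
      qed
      moreover have "n \<notin> E" using ne(1) nn by force
      ultimately show ?thesis using E nn ne nV span_u
        by (intro exI[of _ "insert n E"]) auto
    qed
  qed
  then obtain E where E: "finite E" "E \<subseteq> V" "span E = V"
    "\<And>x y. x \<in> E \<Longrightarrow> y \<in> E \<Longrightarrow> ip x y = (if x = y then 1 else 0)"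
    using assms(1,2) span_superset by metis
  have "independent E"
  proof (subst independent_explicit_finite_subsets, intro allI impI ballI)
    fix A c x assume A: "A \<subseteq> E" "finite A" "(\<Sum>v\<in>A. c v *\<^sub>R v) = 0" and x: "x \<in> A"
    have xV: "x \<in> V" using A x E by auto
    have "ip (\<Sum>v\<in>A. c v *\<^sub>R v) x = (\<Sum>v\<in>A. c v *\<^sub>R ip v x)"
      using E(2) A by (intro linear_map_on_sum[OF V lin[OF xV]]) auto
    also have "\<dots> = (\<Sum>v\<in>A. if v = x then c v else 0)"
      using E(4)[of _ x] A(1) x by (intro sum.cong) (auto simp: subset_iff)
    also have "\<dots> = c x" using x A by simp
    finally have "ip 0 x = c x" using A by simp
    moreover have "ip (0 *\<^sub>R x) x = 0 *\<^sub>R ip x x"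
      using lin[OF xV] xV unfolding linear_map_on_def by blast
    ultimately show "c x = 0" by simp
  qed
  then show ?thesis using E by (auto simp: orthonormal_basis_of_def basis_of_def)
qed

section \<open>Skew matrices orthogonal to a bivector\<close>

definition kdelta :: "nat \<Rightarrow> nat \<Rightarrow> real" where
  "kdelta i j = (if i = j then 1 else 0)"

lemma kdelta_simps [simp]: "kdelta i i = 1" "i \<noteq> j \<Longrightarrow> kdelta i j = 0"
  by (simp_all add: kdelta_def)

lemma sum_kdelta [simp]:
  "(\<Sum>j<n. kdelta i j * f j) = (if i < n then f i else 0)"
  "(\<Sum>j<n. kdelta j i * f j) = (if i < n then f i else 0)"
  "(\<Sum>j<n. f j * kdelta i j) = (if i < n then f i else 0)"
  "(\<Sum>j<n. f j * kdelta j i) = (if i < n then f i else 0)"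
  by (simp_all add: kdelta_def if_distrib[of "\<lambda>x. x * _"] if_distrib[of "\<lambda>x. _ * x"] cong: if_cong)

text \<open>
  A bivector in Darboux normal form, described without reference to an order of the \<open>2 \<times> 2\<close> blocks: on the
  indices in \<open>S\<close>, the matrix \<open>J\<close> is an orthogonal complex structure.
\<close>

locale bivector =
  fixes q :: nat and J :: "nat \<Rightarrow> nat \<Rightarrow> real" and S :: "nat set"
  assumes S_sub: "S \<subseteq> {..<q}" and S_nonempty: "S \<noteq> {}"
    and J_skew: "J i j = - J j i"
    and J_supp: "J i j \<noteq> 0 \<Longrightarrow> i \<in> S \<and> j \<in> S"
    and J_rows: "i \<in> S \<Longrightarrow> k \<in> S \<Longrightarrow> (\<Sum>j<q. J i j * J k j) = kdelta i k"
begin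

lemma finite_S: "finite S" using S_sub finite_subset by blast

lemma card_S_pos: "real (card S) > 0"
  using S_nonempty finite_S by (simp add: card_gt_0_iff)

lemma J_diag [simp]: "J i i = 0" using J_skew[of i i] by simp

lemma J_zero: "i \<notin> S \<Longrightarrow> J i j = 0" "j \<notin> S \<Longrightarrow> J i j = 0" using J_supp by blast+

lemma J_rows': "(\<Sum>j<q. J i j * J k j) = (if i \<in> S then kdelta i k else 0)"
  using J_rows[of i k] by (cases "i \<in> S"; cases "k \<in> S") (auto simp: J_zero kdelta_def)

lemma J_norm: "(\<Sum>i<q. \<Sum>j<q. J i j * J i j) = card S"
proof -
  have "(\<Sum>i<q. \<Sum>j<q. J i j * J i j) = (\<Sum>i<q. if i \<in> S then 1 else 0)"
    by (intro sum.cong) (auto simp: J_rows' kdelta_def)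
  also have "\<dots> = card S"
    using S_sub by (simp add: Int_absorb1 flip: sum.inter_restrict)
  finally show ?thesis .
qed

lemma card_S_ge_2: "card S \<ge> 2"
proof -
  obtain i where i: "i \<in> S" using S_nonempty by blast
  then have "(\<Sum>j<q. J i j * J i j) \<noteq> 0" by (simp add: J_rows kdelta_def)
  then obtain j where "J i j \<noteq> 0" by (metis (no_types, lifting) mult_zero_left sum.neutral)
  then have "{i, j} \<subseteq> S" "i \<noteq> j" using J_supp by auto
  then show ?thesis using card_mono[OF finite_S, of "{i, j}"] by simp
qed

text \<open>
  The orthogonal projection of a matrix along \<open>J\<close>, the space \<open>J\<^sup>\<bottom>\<close> of skew matrices (\<open>zmat\<close>) that is the
  centre of the nilpotent part of the model, its inner product, and its frame, consisting of the projected elementary skew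
  matrices. The factor \<open>1/2\<close> in the inner product compensates for summing over ordered pairs of indices.
\<close>

definition jprod :: "(nat \<Rightarrow> nat \<Rightarrow> real) \<Rightarrow> real" where
  "jprod M = (\<Sum>i<q. \<Sum>j<q. J i j * M i j)"

definition proj :: "(nat \<Rightarrow> nat \<Rightarrow> real) \<Rightarrow> nat \<Rightarrow> nat \<Rightarrow> real" where
  "proj M i j = M i j - jprod M / card S * J i j"

definition zmat :: "(nat \<Rightarrow> nat \<Rightarrow> real) \<Rightarrow> bool" where
  "zmat A \<longleftrightarrow> (\<forall>i j. A i j = - A j i) \<and> jprod A = 0"

definition zdot :: "(nat \<Rightarrow> nat \<Rightarrow> real) \<Rightarrow> (nat \<Rightarrow> nat \<Rightarrow> real) \<Rightarrow> real" where
  "zdot A B = (\<Sum>i<q. \<Sum>j<q. A i j * B i j) / 2"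

definition zframe :: "nat \<Rightarrow> nat \<Rightarrow> nat \<Rightarrow> nat \<Rightarrow> real" where
  "zframe i j = proj (\<lambda>k l. kdelta i k * kdelta j l - kdelta i l * kdelta j k)"

lemma jprod_add: "jprod (\<lambda>i j. M i j + N i j) = jprod M + jprod N"
  by (simp add: jprod_def algebra_simps sum.distrib)

lemma jprod_scale: "jprod (\<lambda>i j. c * M i j) = c * jprod M"
  by (simp add: jprod_def sum_distrib_left algebra_simps)

lemma jprod_diff: "jprod (\<lambda>i j. M i j - N i j) = jprod M - jprod N"
  by (simp add: jprod_def algebra_simps sum_subtractf)

lemma jprod_J: "jprod J = card S"
  by (simp add: jprod_def J_norm)

lemma jprod_cong: "(\<And>i j. i < q \<Longrightarrow> j < q \<Longrightarrow> M i j = N i j) \<Longrightarrow> jprod M = jprod N"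
  by (simp add: jprod_def)

lemma jprod_proj: "jprod (proj M) = 0"
proof -
  have "proj M = (\<lambda>i j. M i j - jprod M / card S * J i j)"
    by (intro ext) (simp add: proj_def)
  then show ?thesis using card_S_pos by (simp only: jprod_diff jprod_scale jprod_J) simp
qed

lemma proj_add: "proj (\<lambda>i j. M i j + N i j) i j = proj M i j + proj N i j"
  by (simp add: proj_def jprod_add add_divide_distrib algebra_simps)

lemma proj_scale: "proj (\<lambda>i j. c * M i j) i j = c * proj M i j"
  by (simp add: proj_def jprod_scale algebra_simps)

lemma proj_cong: "(\<And>i j. i < q \<Longrightarrow> j < q \<Longrightarrow> M i j = N i j) \<Longrightarrow> i < q \<Longrightarrow> j < q \<Longrightarrow> proj M i j = proj N i j"
  using jprod_cong[of M N] by (simp add: proj_def)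

lemma zmat_proj: "(\<And>i j. M i j = - M j i) \<Longrightarrow> zmat (proj M)"
proof -
  assume M: "\<And>i j. M i j = - M j i"
  have "proj M i j = - proj M j i" for i j
    using M[of i j] J_skew[of i j] by (simp add: proj_def)
  then show "zmat (proj M)" unfolding zmat_def using jprod_proj by blast
qed

lemma zmat_skew: "zmat A \<Longrightarrow> A i j = - A j i"
  unfolding zmat_def by blast

lemma zmat_jprod: "zmat A \<Longrightarrow> jprod A = 0"
  unfolding zmat_def by blast

lemma zdot_proj: "zmat A \<Longrightarrow> zdot A (proj M) = (\<Sum>i<q. \<Sum>j<q. A i j * M i j) / 2"
proof -
  assume A: "zmat A"
  have "zdot A (proj M) = (\<Sum>i<q. \<Sum>j<q. A i j * M i j - jprod M / card S * (J i j * A i j)) / 2"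
    by (simp add: zdot_def proj_def algebra_simps)
  also have "\<dots> = ((\<Sum>i<q. \<Sum>j<q. A i j * M i j) - jprod M / card S * jprod A) / 2"
    by (simp only: sum_subtractf jprod_def[of A] sum_distrib_left)
  finally show ?thesis using zmat_jprod[OF A] by simp
qed

lemma zdot_commute: "zdot A B = zdot B A"
  by (simp add: zdot_def mult.commute)

lemma zmat_zframe: "zmat (zframe i j)"
  unfolding zframe_def by (rule zmat_proj) simp

text \<open>
  Taking a matrix entry is pairing with a frame vector. This turns traces of operators on \<open>J\<^sup>\<bottom>\<close> into
  sums of inner products.
\<close>

lemma zdot_zframe:
  assumes "zmat A" "i < q" "j < q"
  shows "zdot A (zframe i j) = A i j"
proof -
  have "zdot A (zframe i j) = ((\<Sum>k<q. \<Sum>l<q. A k l * (kdelta i k * kdelta j l)) -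
      (\<Sum>k<q. \<Sum>l<q. A k l * (kdelta i l * kdelta j k))) / 2"
    unfolding zframe_def zdot_proj[OF assms(1)] by (simp add: algebra_simps sum_subtractf)
  also have "(\<Sum>k<q. \<Sum>l<q. A k l * (kdelta i k * kdelta j l)) = (\<Sum>k<q. kdelta i k * (\<Sum>l<q. A k l * kdelta j l))"
    by (simp only: sum_distrib_left mult_ac)
  also have "(\<Sum>k<q. \<Sum>l<q. A k l * (kdelta i l * kdelta j k)) = (\<Sum>k<q. kdelta j k * (\<Sum>l<q. A k l * kdelta i l))"
    by (simp only: sum_distrib_left mult_ac)
  finally show ?thesis using assms zmat_skew[OF assms(1), of j i] by simp
qed

lemma jprod_elem:
  "jprod (\<lambda>k l. kdelta i k * kdelta j l - kdelta i l * kdelta j k)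
    = (if i < q \<and> j < q then 2 * J i j else 0)"
proof -
  have "jprod (\<lambda>k l. kdelta i k * kdelta j l) = (\<Sum>k<q. kdelta i k * (\<Sum>l<q. J k l * kdelta j l))"
    unfolding jprod_def by (simp only: sum_distrib_left mult_ac)
  moreover have "jprod (\<lambda>k l. kdelta i l * kdelta j k) = (\<Sum>k<q. kdelta j k * (\<Sum>l<q. J k l * kdelta i l))"
    unfolding jprod_def by (simp only: sum_distrib_left mult_ac)
  ultimately show ?thesis using J_skew[of j i] by (auto simp: jprod_diff)
qed

lemma zframe_entry:
  "i < q \<Longrightarrow> j < q \<Longrightarrow> zframe i j k l
    = kdelta i k * kdelta j l - kdelta i l * kdelta j k - 2 * J i j / card S * J k l"
  by (simp add: zframe_def proj_def jprod_elem)

lemma zframe_self: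
  "i < q \<Longrightarrow> j < q \<Longrightarrow> zframe i j i j = (1 - kdelta i j) - 2 * (J i j * J i j) / card S"
  by (auto simp add: zframe_entry kdelta_def)

lemma zmat_frame_expansion:
  assumes "zmat A" "k < q" "l < q"
  shows "(\<Sum>i<q. \<Sum>j<q. A i j / 2 * zframe i j k l) = A k l"
proof -
  have "zframe i j k l = zframe k l i j" if "i < q" "j < q" for i j
    using that assms by (auto simp: zframe_entry kdelta_def)
  then have "(\<Sum>i<q. \<Sum>j<q. A i j / 2 * zframe i j k l) = zdot A (zframe k l)"
    by (simp add: zdot_def sum_divide_distrib)
  then show ?thesis using assms zdot_zframe by simp
qed

end

text \<open>
  The weights \<open>d\<close> are the eigenvalues of the derivation on \<open>v\<close>. As \<open>d\<close> is constant on \<open>S\<close>, the matrix \<open>J\<close> is an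
  eigenvector of the induced action on skew matrices. The lower bound keeps the radicand in \<open>sg\<close>
  nonnegative, also on the diagonal.
\<close>

locale weighted_bivector = bivector +
  fixes d :: "nat \<Rightarrow> real" and a :: real
  assumes d_on: "i \<in> S \<Longrightarrow> d i = a" and d_ge: "d i \<ge> 1/2"
begin

text \<open>
  The weights of the bracket. Their value is forced by the soliton equation on the centre, where the
  Ricci operator multiplies the entry \<open>(i, j)\<close> by \<open>sg i j ^ 2 / 2\<close> and the equation demands \<open>d i + d j - 1\<close>.
\<close>

definition sg :: "nat \<Rightarrow> nat \<Rightarrow> real" where
  "sg i j = sqrt (2 * (d i + d j - 1))"

lemma sg_sym: "sg i j = sg j i" by (simp add: sg_def add.commute)

lemma sg_sq: "sg i j * sg i j = 2 * (d i + d j - 1)"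
  using d_ge[of i] d_ge[of j] by (simp add: sg_def)

text \<open>
  The common value of \<open>sg\<close> on the support of \<open>J\<close>.
\<close>

definition al :: real where "al = sqrt (2 * (2 * a - 1))"

lemma al_sq: "al * al = 2 * (2 * a - 1)"
proof -
  obtain i where "i \<in> S" using S_nonempty by blast
  then show ?thesis using d_ge[of i] d_on[of i] by (simp add: al_def)
qed

lemma J_sg: "J i j * sg i j = al * J i j" "sg i j * J i j = al * J i j"
  using J_supp[of i j] by (cases "J i j = 0"; simp add: sg_def al_def d_on)+

lemma J_d: "J i j * (d i + d j) = 2 * a * J i j" "(d i + d j) * J i j = 2 * a * J i j"
  using J_supp[of i j] by (cases "J i j = 0"; simp add: d_on)+

text \<open>
  The bracket of the nilpotent algebra, and the adjoint family of skew operators \<open>Jop A\<close> on \<open>v\<close> given by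
  \<open>\<langle>Jop A w, u\<rangle> = \<langle>A, [w, u]\<rangle>\<close>.
\<close>

definition wedge :: "(nat \<Rightarrow> real) \<Rightarrow> (nat \<Rightarrow> real) \<Rightarrow> nat \<Rightarrow> nat \<Rightarrow> real" where
  "wedge v w = proj (\<lambda>i j. sg i j * (v i * w j - v j * w i))"

definition Jop :: "(nat \<Rightarrow> nat \<Rightarrow> real) \<Rightarrow> (nat \<Rightarrow> real) \<Rightarrow> nat \<Rightarrow> real" where
  "Jop A w j = (\<Sum>i<q. sg i j * A i j * w i)"

definition dot :: "(nat \<Rightarrow> real) \<Rightarrow> (nat \<Rightarrow> real) \<Rightarrow> real" where
  "dot v w = (\<Sum>i<q. v i * w i)"

lemma zmat_wedge: "zmat (wedge v w)"
  unfolding wedge_def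
proof (rule zmat_proj)
  fix i j show "sg i j * (v i * w j - v j * w i) = - (sg j i * (v j * w i - v i * w j))"
    using sg_sym[of j i] by (simp only: mult_minus_right[symmetric] minus_diff_eq)
qed

text \<open>
  The projection commutes with the action of the derivation because \<open>J\<close> is an eigenvector of it.
\<close>

lemma proj_weight: "proj (\<lambda>i j. (d i + d j) * M i j) i j = (d i + d j) * proj M i j"
proof -
  have "jprod (\<lambda>i j. (d i + d j) * M i j) = 2 * a * jprod M"
    unfolding jprod_def sum_distrib_left
    by (intro sum.cong refl) (metis (no_types, opaque_lifting) J_d(1) mult.assoc)
  moreover have "(d i + d j) * (jprod M / card S * J i j) = jprod M / card S * ((d i + d j) * J i j)"
    by (simp only: mult_ac)
  ultimately show ?thesis unfolding proj_def J_d right_diff_distrib by auto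
qed

lemma zmat_weight: "zmat A \<Longrightarrow> zmat (\<lambda>i j. (d i + d j) * A i j)"
proof -
  assume A: "zmat A"
  have "jprod (\<lambda>i j. (d i + d j) * A i j) = 2 * a * jprod A"
    unfolding jprod_def sum_distrib_left
    by (intro sum.cong refl) (metis (no_types, opaque_lifting) J_d(1) mult.assoc)
  moreover have "(d i + d j) * A i j = - ((d j + d i) * A j i)" for i j
    by (subst zmat_skew[OF A]) (simp add: add.commute)
  moreover have "jprod A = 0" by (rule zmat_jprod[OF A])
  ultimately show ?thesis unfolding zmat_def by (metis mult_zero_right)
qed

lemma wedge_derivation:
  "wedge (\<lambda>i. d i * v i) w i j + wedge v (\<lambda>i. d i * w i) i j = (d i + d j) * wedge v w i j"
  unfolding wedge_def proj_weight[symmetric] proj_add[symmetric]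
  by (simp add: algebra_simps)

lemma wedge_swap: "wedge v w i j = - wedge w v i j"
proof -
  have "wedge v w i j = proj (\<lambda>i j. -1 * (sg i j * (w i * v j - w j * v i))) i j"
    unfolding wedge_def by (simp add: algebra_simps)
  then show ?thesis unfolding proj_scale wedge_def by simp
qed

lemma wedge_add: "wedge (\<lambda>i. v i + v' i) w i j = wedge v w i j + wedge v' w i j"
  unfolding wedge_def proj_add[symmetric] by (simp add: algebra_simps)

lemma wedge_scale: "wedge (\<lambda>i. c * v i) w i j = c * wedge v w i j"
  unfolding wedge_def proj_scale[symmetric] by (simp add: algebra_simps)

lemma wedge_add_right: "wedge v (\<lambda>i. w i + w' i) i j = wedge v w i j + wedge v w' i j"
  unfolding wedge_def proj_add[symmetric] by (simp add: algebra_simps)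

lemma wedge_scale_right: "wedge v (\<lambda>i. c * w i) i j = c * wedge v w i j"
  unfolding wedge_def proj_scale[symmetric] by (simp add: algebra_simps)

lemma wedge_cong:
  "(\<And>i. i < q \<Longrightarrow> v i = v' i) \<Longrightarrow> (\<And>i. i < q \<Longrightarrow> w i = w' i) \<Longrightarrow> i < q \<Longrightarrow> j < q \<Longrightarrow>
    wedge v w i j = wedge v' w' i j"
  unfolding wedge_def by (rule proj_cong) auto

lemma Jop_adjoint:
  assumes "zmat C" shows "dot (Jop C w) u = zdot C (wedge w u)"
proof -
  have C: "C j i = - C i j" for i j by (rule zmat_skew[OF assms])
  have 1: "dot (Jop C w) u = (\<Sum>i<q. \<Sum>j<q. C i j * (sg i j * (w i * u j)))"
    unfolding dot_def Jop_def by (subst sum.swap) (simp add: sum_distrib_left sum_distrib_right mult_ac)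
  have 2: "dot (Jop C w) u = (\<Sum>i<q. \<Sum>j<q. - (C i j * (sg i j * (w j * u i))))"
    unfolding dot_def Jop_def sum_distrib_right
  proof (intro sum.cong refl)
    fix j i
    show "sg i j * C i j * w i * u j = - (C j i * (sg j i * (w i * u j)))"
      unfolding C[of j i] sg_sym[of j i] by simp
  qed
  have "zdot C (wedge w u) = (\<Sum>i<q. \<Sum>j<q. C i j * (sg i j * (w i * u j)) - C i j * (sg i j * (w j * u i))) / 2"
    unfolding wedge_def zdot_proj[OF assms] by (simp add: algebra_simps)
  also have "\<dots> = (dot (Jop C w) u + dot (Jop C w) u) / 2"
    by (subst 1, subst 2) (simp add: sum_subtractf sum_negf)
  finally show ?thesis by simp
qed

lemma Jop_skew:
  assumes "zmat C" shows "dot (Jop C w) u = - dot (Jop C u) w"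
proof -
  have "zdot C (wedge w u) = zdot C (\<lambda>i j. - wedge u w i j)"
    by (simp add: zdot_def wedge_swap[of w u])
  also have "\<dots> = - zdot C (wedge u w)" by (simp add: zdot_def sum_negf)
  finally show ?thesis using Jop_adjoint[OF assms] by simp
qed

text \<open>
  The \<open>i\<close>-th diagonal entry of \<open>- \<Sum> (Jop A)\<^sup>2\<close>, the sum running over an orthonormal basis of \<open>J\<^sup>\<bottom>\<close>. The first
  summand is the contribution of all skew matrices, the second one removes that of \<open>J\<close> itself.
\<close>

definition casimir :: "nat \<Rightarrow> real" where
  "casimir i = (\<Sum>j\<in>{..<q} - {i}. 2 * (d i + d j - 1)) - (if i \<in> S then 4 * (2 * a - 1) / card S else 0)"

text \<open>
  By adjointness, the left-hand side is \<open>\<Sum> \<langle>[e i, w], [v, e i]\<rangle>\<close>, hence the matrix coefficient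
  \<open>\<langle>(\<Sum> (Jop A)\<^sup>2) v, w\<rangle>\<close>. The operator \<open>\<Sum> (Jop A)\<^sup>2\<close> is diagonal: elementary skew matrices contribute a diagonal operator, and so
  does \<open>J\<close>, whose square is minus the projection to the coordinates in \<open>S\<close>.
\<close>

lemma Jop_wedge_sum:
  "(\<Sum>i<q. Jop (wedge (kdelta i) w) v i) = - (\<Sum>k<q. casimir k * (v k * w k))"
proof -
  let ?n = "real (card S)"
  have jp: "jprod (\<lambda>k l. sg k l * (kdelta i k * w l - kdelta i l * w k)) = 2 * al * (\<Sum>l<q. J i l * w l)"
    if i: "i < q" for i
  proof -
    have "jprod (\<lambda>k l. sg k l * (kdelta i k * w l - kdelta i l * w k))
      = (\<Sum>k<q. \<Sum>l<q. al * (J k l * (kdelta i k * w l)) - al * (J k l * (kdelta i l * w k)))"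
      unfolding jprod_def mult.assoc[symmetric] J_sg by (simp add: algebra_simps)
    also have "\<dots> = al * (\<Sum>k<q. kdelta i k * (\<Sum>l<q. J k l * w l)) - al * (\<Sum>k<q. w k * (\<Sum>l<q. J k l * kdelta i l))"
      by (simp only: sum_subtractf sum_distrib_left mult_ac)
    also have "(\<Sum>k<q. w k * (\<Sum>l<q. J k l * kdelta i l)) = - (\<Sum>l<q. J i l * w l)"
      using i unfolding sum_negf[symmetric] by (intro sum.cong refl) (simp, metis J_skew mult.commute mult_minus_right)
    finally show ?thesis using i by simp
  qed
  have "(\<Sum>i<q. Jop (wedge (kdelta i) w) v i) =
    (\<Sum>i<q. \<Sum>k<q. sg k i * sg k i * (kdelta i k * w i - w k) * v k) -
    (\<Sum>i<q. \<Sum>k<q. 2 * al * (\<Sum>l<q. J i l * w l) / ?n * (sg k i * J k i) * v k)"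
    unfolding Jop_def wedge_def proj_def sum_subtractf[symmetric]
  proof (intro sum.cong refl)
    fix i k assume "i \<in> {..<q}"
    then have i: "i < q" by simp
    show "sg k i * (sg k i * (kdelta i k * w i - kdelta i i * w k) - jprod (\<lambda>k l. sg k l * (kdelta i k * w l - kdelta i l * w k)) / ?n * J k i) * v k
      = sg k i * sg k i * (kdelta i k * w i - w k) * v k - 2 * al * (\<Sum>l<q. J i l * w l) / ?n * (sg k i * J k i) * v k"
      unfolding jp[OF i] by (simp add: kdelta_def algebra_simps)
  qed
  also have "(\<Sum>i<q. \<Sum>k<q. sg k i * sg k i * (kdelta i k * w i - w k) * v k)
     = (\<Sum>k<q. - ((\<Sum>i\<in>{..<q}-{k}. 2 * (d k + d i - 1)) * (v k * w k)))"
  proof (subst sum.swap, intro sum.cong refl)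
    fix k assume k: "k \<in> {..<q}"
    have "(\<Sum>i<q. sg k i * sg k i * (kdelta i k * w i - w k) * v k)
      = (\<Sum>i\<in>{..<q}-{k}. sg k i * sg k i * (kdelta i k * w i - w k) * v k)"
      using k by (subst sum.remove[of _ k]) (auto simp: kdelta_def)
    also have "\<dots> = (\<Sum>i\<in>{..<q}-{k}. - (2 * (d k + d i - 1) * (v k * w k)))"
      by (intro sum.cong refl) (auto simp: kdelta_def sg_sq algebra_simps)
    finally show "(\<Sum>i<q. sg k i * sg k i * (kdelta i k * w i - w k) * v k)
      = - ((\<Sum>i\<in>{..<q}-{k}. 2 * (d k + d i - 1)) * (v k * w k))"
      by (simp add: sum_distrib_right sum_negf)
  qed
  also have "(\<Sum>i<q. \<Sum>k<q. 2 * al * (\<Sum>l<q. J i l * w l) / ?n * (sg k i * J k i) * v k)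
    = (\<Sum>i<q. \<Sum>k<q. \<Sum>l<q. 2 * (al * al) / ?n * (w l * v k) * (J i l * J k i))"
    unfolding J_sg by (simp add: sum_distrib_left sum_distrib_right sum_divide_distrib mult_ac)
  also have "\<dots> = (\<Sum>k<q. \<Sum>l<q. \<Sum>i<q. 2 * (al * al) / ?n * (w l * v k) * (J i l * J k i))"
    by (rule trans[OF sum.swap], rule sum.cong[OF refl], rule sum.swap)
  also have "\<dots> = (\<Sum>k<q. \<Sum>l<q. - (2 * (al * al) / ?n * (w l * v k) * (\<Sum>i<q. J k i * J l i)))"
    unfolding sum_distrib_left sum_negf[symmetric]
    by (intro sum.cong refl) (metis (no_types, opaque_lifting) J_skew mult.commute mult_minus_right)
  also have "\<dots> = (\<Sum>k<q. - (if k \<in> S then 4 * (2 * a - 1) / ?n else 0) * (v k * w k))"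
  proof (intro sum.cong refl)
    fix k assume k: "k \<in> {..<q}"
    show "(\<Sum>l<q. - (2 * (al * al) / ?n * (w l * v k) * (\<Sum>i<q. J k i * J l i)))
       = - (if k \<in> S then 4 * (2 * a - 1) / ?n else 0) * (v k * w k)"
    proof (cases "k \<in> S")
      case True
      then show ?thesis using k
        unfolding sum_negf J_rows' by (simp only: True if_True sum_kdelta lessThan_iff al_sq) simp
    qed (simp add: J_rows')
  qed
  finally show ?thesis
    by (simp add: casimir_def sum_negf sum_subtractf algebra_simps flip: sum.distrib)
qed

text \<open>
  The traces of the derivation and of its square, the centre being traced with the frame.
\<close>

definition trace_der :: real where
  "trace_der = (\<Sum>i<q. d i) + (\<Sum>i<q. \<Sum>j<q. (d i + d j) * zframe i j i j) / 2"

definition trace_der_sq :: real where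
  "trace_der_sq = (\<Sum>i<q. d i * d i) + (\<Sum>i<q. \<Sum>j<q. (d i + d j) * (d i + d j) * zframe i j i j) / 2"

lemma trace_der_pos: "trace_der > 0"
proof -
  obtain i where i: "i \<in> S" "i < q" using S_nonempty S_sub by blast
  have "zframe i j i j \<ge> 0" if "i < q" "j < q" for i j
  proof (cases "i = j")
    case False
    have "J i j * J i j \<le> (\<Sum>j<q. J i j * J i j)"
      using that by (intro member_le_sum) auto
    also have "\<dots> \<le> 1" by (simp add: J_rows' kdelta_def)
    finally have "J i j * J i j \<le> 1" .
    then show ?thesis using card_S_ge_2 card_S_pos False that
      by (simp add: zframe_self kdelta_def divide_le_eq)
  qed (simp add: that zframe_self kdelta_def)
  moreover have "d i + d j \<ge> 0" for i j using d_ge[of i] d_ge[of j] by simp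
  ultimately have "(\<Sum>i<q. \<Sum>j<q. (d i + d j) * zframe i j i j) \<ge> 0"
    by (intro sum_nonneg mult_nonneg_nonneg) auto
  moreover have "(\<Sum>i<q. d i) > 0"
    using i d_ge by (intro sum_pos) (auto intro: less_le_trans[of 0 "1/2"])
  ultimately show ?thesis by (simp add: trace_der_def)
qed

end

text \<open>
  The last condition is the soliton equation \<open>Ric = -1 + D\<close> on \<open>v\<close>; the one on the centre is built into \<open>sg\<close>.
  Strict positivity of the weights off the diagonal makes the rescaling by \<open>sg\<close> invertible.
\<close>

locale soliton = weighted_bivector +
  assumes d_gt: "i < q \<Longrightarrow> j < q \<Longrightarrow> i \<noteq> j \<Longrightarrow> d i + d j > 1"
    and einstein_v: "i < q \<Longrightarrow> d i + casimir i / 2 = 1"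
begin

text \<open>
  A derivation is orthogonal to the Ricci operator of a nilpotent metric algebra. For the derivation \<open>D\<close> of a
  soliton this gives \<open>0 = tr (Ric D) = tr D\<^sup>2 - tr D\<close>. Concretely, summing the equations on the centre against
  \<open>d i + d j\<close> produces the same Casimir terms as summing those on \<open>v\<close> against \<open>d i\<close>.
\<close>

lemma trace_der_eq_trace_der_sq: "trace_der = trace_der_sq"
proof -
  let ?n = "real (card S)"
  have "(\<Sum>i<q. \<Sum>j<q. (d i + d j) * (d i + d j - 1) * zframe i j i j)
     = (\<Sum>i<q. \<Sum>j<q. (d i + d j) * (d i + d j - 1) * (1 - kdelta i j))
      - (\<Sum>i<q. \<Sum>j<q. (2 * a * (2 * a - 1) * 2 / ?n) * (J i j * J i j))"
    unfolding sum_subtractf[symmetric]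
  proof (intro sum.cong refl)
    fix i j assume "i \<in> {..<q}" "j \<in> {..<q}"
    moreover have "(d i + d j) * (d i + d j - 1) * (J i j * J i j) = 2 * a * (2 * a - 1) * (J i j * J i j)"
      using J_supp[of i j] by (cases "J i j = 0") (auto simp: d_on)
    ultimately show "(d i + d j) * (d i + d j - 1) * zframe i j i j
        = (d i + d j) * (d i + d j - 1) * (1 - kdelta i j) - (2 * a * (2 * a - 1) * 2 / ?n) * (J i j * J i j)"
    proof -
      assume ij: "i \<in> {..<q}" "j \<in> {..<q}" and
        e: "(d i + d j) * (d i + d j - 1) * (J i j * J i j) = 2 * a * (2 * a - 1) * (J i j * J i j)"
      have "(d i + d j) * (d i + d j - 1) * (2 * (J i j * J i j) / ?n)
        = (d i + d j) * (d i + d j - 1) * (J i j * J i j) * (2 / ?n)" by simp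
      also have "\<dots> = (2 * a * (2 * a - 1) * 2 / ?n) * (J i j * J i j)" unfolding e by simp
      finally show ?thesis using ij by (simp only: zframe_self lessThan_iff right_diff_distrib)
    qed
  qed
  also have "(\<Sum>i<q. \<Sum>j<q. (2 * a * (2 * a - 1) * 2 / ?n) * (J i j * J i j)) = 2 * a * (2 * a - 1) * 2"
    unfolding sum_distrib_left[symmetric] J_norm using card_S_pos by simp
  also have "(\<Sum>i<q. \<Sum>j<q. (d i + d j) * (d i + d j - 1) * (1 - kdelta i j))
    = (\<Sum>i<q. \<Sum>j<q. d i * ((d i + d j - 1) * (1 - kdelta i j)))
      + (\<Sum>i<q. \<Sum>j<q. d j * ((d i + d j - 1) * (1 - kdelta i j)))"
    by (simp add: algebra_simps flip: sum.distrib)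
  also have "(\<Sum>i<q. \<Sum>j<q. d j * ((d i + d j - 1) * (1 - kdelta i j)))
    = (\<Sum>i<q. \<Sum>j<q. d i * ((d i + d j - 1) * (1 - kdelta i j)))"
    by (rule trans[OF sum.swap], intro sum.cong refl) (auto simp: kdelta_def algebra_simps)
  also have "(\<Sum>i<q. \<Sum>j<q. d i * ((d i + d j - 1) * (1 - kdelta i j)))
    = (\<Sum>i<q. d i * (\<Sum>j\<in>{..<q}-{i}. d i + d j - 1))"
  proof (intro sum.cong refl)
    fix i assume i: "i \<in> {..<q}"
    have "(\<Sum>j<q. d i * ((d i + d j - 1) * (1 - kdelta i j))) = (\<Sum>j\<in>{..<q}-{i}. d i * (d i + d j - 1))"
      using i by (subst sum.remove[of _ i]) (auto simp: kdelta_def intro!: sum.cong)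
    then show "(\<Sum>j<q. d i * ((d i + d j - 1) * (1 - kdelta i j))) = d i * (\<Sum>j\<in>{..<q}-{i}. d i + d j - 1)"
      by (simp add: sum_distrib_left)
  qed
  finally have 1: "(\<Sum>i<q. \<Sum>j<q. (d i + d j) * (d i + d j - 1) * zframe i j i j)
     = 2 * (\<Sum>i<q. d i * (\<Sum>j\<in>{..<q}-{i}. d i + d j - 1)) - 2 * a * (2 * a - 1) * 2" by simp
  have "(\<Sum>i<q. d i * (\<Sum>j\<in>{..<q}-{i}. d i + d j - 1))
     = (\<Sum>i<q. (d i - d i * d i) + (if i \<in> S then a * (2 * (2 * a - 1) / ?n) else 0))"
  proof (intro sum.cong refl)
    fix i assume i: "i \<in> {..<q}"
    have "(\<Sum>j\<in>{..<q}-{i}. d i + d j - 1) = casimir i / 2 + (if i \<in> S then 2 * (2 * a - 1) / ?n else 0)"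
      unfolding casimir_def sum_distrib_left[symmetric] by (simp add: diff_divide_distrib)
    also have "casimir i / 2 = 1 - d i" using einstein_v i by (simp add: algebra_simps)
    finally have Y: "(\<Sum>j\<in>{..<q}-{i}. d i + d j - 1) = 1 - d i + (if i \<in> S then 2 * (2 * a - 1) / ?n else 0)" .
    show "d i * (\<Sum>j\<in>{..<q}-{i}. d i + d j - 1)
      = (d i - d i * d i) + (if i \<in> S then a * (2 * (2 * a - 1) / ?n) else 0)"
      unfolding Y by (cases "i \<in> S") (simp_all add: d_on algebra_simps)
  qed
  also have "\<dots> = (\<Sum>i<q. d i) - (\<Sum>i<q. d i * d i) + 2 * a * (2 * a - 1)"
    using S_sub card_S_pos by (simp add: sum.distrib sum_subtractf Int_absorb1 flip: sum.inter_restrict)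
  finally have 2: "(\<Sum>i<q. \<Sum>j<q. (d i + d j) * (d i + d j - 1) * zframe i j i j)
     = 2 * (\<Sum>i<q. d i) - 2 * (\<Sum>i<q. d i * d i)" using 1 by simp
  have "(\<Sum>i<q. \<Sum>j<q. (d i + d j) * (d i + d j - 1) * zframe i j i j)
    = (\<Sum>i<q. \<Sum>j<q. (d i + d j) * (d i + d j) * zframe i j i j)
     - (\<Sum>i<q. \<Sum>j<q. (d i + d j) * zframe i j i j)"
    unfolding sum_subtractf[symmetric] by (simp add: algebra_simps)
  then show ?thesis using 2 by (simp add: trace_der_def trace_der_sq_def)
qed

end

section \<open>Coordinates on the model space\<close>

text \<open>
  A real number, a vector in \<open>\<real>\<^sup>q\<close> and a \<open>q \<times> q\<close> matrix are stored in one finitely supported sequence, at the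
  positions that encode \<open>(0, 0)\<close>, \<open>(0, i + 1)\<close> and \<open>(i + 1, j + 1)\<close>. The functions \<open>hc\<close>, \<open>vc\<close> and \<open>ac\<close> read the
  three parts back.
\<close>

definition triple :: "nat \<Rightarrow> real \<Rightarrow> (nat \<Rightarrow> real) \<Rightarrow> (nat \<Rightarrow> nat \<Rightarrow> real) \<Rightarrow> (nat \<Rightarrow>\<^sub>0 real)" where
  "triple q h v A = Abs_poly_mapping (\<lambda>n. case prod_decode n of
     (0, 0) \<Rightarrow> h
   | (0, Suc i) \<Rightarrow> if i < q then v i else 0
   | (Suc i, 0) \<Rightarrow> 0
   | (Suc i, Suc j) \<Rightarrow> if i < q \<and> j < q then A i j else 0)"

definition hc :: "(nat \<Rightarrow>\<^sub>0 real) \<Rightarrow> real" where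
  "hc x = Poly_Mapping.lookup x (prod_encode (0, 0))"

definition vc :: "(nat \<Rightarrow>\<^sub>0 real) \<Rightarrow> nat \<Rightarrow> real" where
  "vc x i = Poly_Mapping.lookup x (prod_encode (0, Suc i))"

definition ac :: "(nat \<Rightarrow>\<^sub>0 real) \<Rightarrow> nat \<Rightarrow> nat \<Rightarrow> real" where
  "ac x i j = Poly_Mapping.lookup x (prod_encode (Suc i, Suc j))"

lemma lookup_triple: "Poly_Mapping.lookup (triple q h v A) n = (case prod_decode n of
     (0, 0) \<Rightarrow> h
   | (0, Suc i) \<Rightarrow> if i < q then v i else 0
   | (Suc i, 0) \<Rightarrow> 0
   | (Suc i, Suc j) \<Rightarrow> if i < q \<and> j < q then A i j else 0)"
  unfolding triple_def
proof (subst Abs_poly_mapping_inverse; (simp only: mem_Collect_eq)?)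
  have "n \<in> prod_encode ` ({..q} \<times> {..q})"
    if "(case prod_decode n of
     (0, 0) \<Rightarrow> h
   | (0, Suc i) \<Rightarrow> if i < q then v i else 0
   | (Suc i, 0) \<Rightarrow> 0
   | (Suc i, Suc j) \<Rightarrow> if i < q \<and> j < q then A i j else 0) \<noteq> 0" for n
  proof -
    obtain r s where rs: "prod_decode n = (r, s)" by force
    then have "n = prod_encode (r, s)" by (metis prod_decode_inverse)
    moreover have "r \<le> q" "s \<le> q" using that rs by (auto split: nat.splits if_splits)
    ultimately show ?thesis by auto
  qed
  then show "finite {n. (case prod_decode n of
     (0, 0) \<Rightarrow> h
   | (0, Suc i) \<Rightarrow> if i < q then v i else 0
   | (Suc i, 0) \<Rightarrow> 0
   | (Suc i, Suc j) \<Rightarrow> if i < q \<and> j < q then A i j else 0) \<noteq> 0}"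
    by (intro finite_subset[OF subsetI finite_imageI[of "{..q} \<times> {..q}" prod_encode]]) simp_all
qed

lemma lookup_scaleR: "Poly_Mapping.lookup (c *\<^sub>R x) n = c * Poly_Mapping.lookup x n"
proof -
  have "finite {i. c * Poly_Mapping.lookup x i \<noteq> 0}"
    by (rule finite_subset[of _ "{i. Poly_Mapping.lookup x i \<noteq> 0}"]) auto
  then show ?thesis by (simp add: scaleR_poly_mapping_def)
qed

lemma hc_triple [simp]: "hc (triple q h v A) = h"
  by (simp add: hc_def lookup_triple)

lemma vc_triple: "vc (triple q h v A) = (\<lambda>i. if i < q then v i else 0)"
  by (simp add: vc_def lookup_triple fun_eq_iff)

lemma ac_triple: "ac (triple q h v A) = (\<lambda>i j. if i < q \<and> j < q then A i j else 0)"
  by (simp add: ac_def lookup_triple fun_eq_iff)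

lemma triple_cong:
  "h = h' \<Longrightarrow> (\<And>i. i < q \<Longrightarrow> v i = v' i) \<Longrightarrow> (\<And>i j. i < q \<Longrightarrow> j < q \<Longrightarrow> A i j = A' i j) \<Longrightarrow>
    triple q h v A = triple q h' v' A'"
  by (rule poly_mapping_eqI) (simp add: lookup_triple split: prod.split nat.split)

lemma triple_add: "triple q h v A + triple q h' v' A' = triple q (h + h') (\<lambda>i. v i + v' i) (\<lambda>i j. A i j + A' i j)"
  by (rule poly_mapping_eqI) (simp add: lookup_triple lookup_add split: prod.split nat.split)

lemma triple_scale: "c *\<^sub>R triple q h v A = triple q (c * h) (\<lambda>i. c * v i) (\<lambda>i j. c * A i j)"
  by (rule poly_mapping_eqI) (simp add: lookup_triple lookup_scaleR split: prod.split nat.split)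

lemma triple_0: "triple q 0 (\<lambda>i. 0) (\<lambda>i j. 0) = 0"
  by (rule poly_mapping_eqI) (simp add: lookup_triple split: prod.split nat.split)

lemma coord_add:
  "hc (x + y) = hc x + hc y" "vc (x + y) = (\<lambda>i. vc x i + vc y i)" "ac (x + y) = (\<lambda>i j. ac x i j + ac y i j)"
  by (simp_all add: hc_def vc_def ac_def lookup_add fun_eq_iff)

lemma coord_scale:
  "hc (c *\<^sub>R x) = c * hc x" "vc (c *\<^sub>R x) = (\<lambda>i. c * vc x i)" "ac (c *\<^sub>R x) = (\<lambda>i j. c * ac x i j)"
  by (simp_all add: hc_def vc_def ac_def lookup_scaleR fun_eq_iff)

lemma coord_0 [simp]: "hc 0 = 0" "vc 0 = (\<lambda>i. 0)" "ac 0 = (\<lambda>i j. 0)"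
  by (simp_all add: hc_def vc_def ac_def fun_eq_iff)

lemma coord_sum:
  "hc (sum f I) = (\<Sum>s\<in>I. hc (f s))" "vc (sum f I) i = (\<Sum>s\<in>I. vc (f s) i)"
  "ac (sum f I) i j = (\<Sum>s\<in>I. ac (f s) i j)"
  by (induction I rule: infinite_finite_induct) (simp_all add: coord_add)

context weighted_bivector
begin

lemma zmat_trunc:
  assumes "zmat A" shows "zmat (\<lambda>i j. if i < q \<and> j < q then A i j else 0)"
proof -
  have "jprod (\<lambda>i j. if i < q \<and> j < q then A i j else 0) = jprod A"
    by (rule jprod_cong) simp
  then show ?thesis using zmat_jprod[OF assms] zmat_skew[OF assms] unfolding zmat_def by (smt (verit))
qed

lemma zmat_add: "zmat A \<Longrightarrow> zmat B \<Longrightarrow> zmat (\<lambda>i j. A i j + B i j)"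
  unfolding zmat_def jprod_add by (smt (verit))

lemma zmat_scale: "zmat A \<Longrightarrow> zmat (\<lambda>i j. c * A i j)"
  unfolding zmat_def jprod_scale by (metis mult_minus_right mult_zero_right)

lemma zmat_0: "zmat (\<lambda>i j. 0)"
  by (simp add: zmat_def jprod_def)

text \<open>
  Entries beyond \<open>q\<close> are cut off when they are stored; none of the operations depends on them.
\<close>

lemma trunc_simps:
  "Jop (\<lambda>i j. if i < q \<and> j < q then A i j else 0) w i = (if i < q then Jop A w i else 0)"
  "Jop A (\<lambda>i. if i < q then w i else 0) = Jop A w"
  "dot (\<lambda>i. if i < q then w i else 0) u = dot w u"
  "dot u (\<lambda>i. if i < q then w i else 0) = dot u w"
  "zdot (\<lambda>i j. if i < q \<and> j < q then A i j else 0) B = zdot A B"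
  "zdot B (\<lambda>i j. if i < q \<and> j < q then A i j else 0) = zdot B A"
  "i < q \<Longrightarrow> j < q \<Longrightarrow> wedge (\<lambda>i. if i < q then v i else 0) w i j = wedge v w i j"
  "i < q \<Longrightarrow> j < q \<Longrightarrow> wedge w (\<lambda>i. if i < q then v i else 0) i j = wedge w v i j"
  by (auto simp: Jop_def dot_def zdot_def intro!: sum.cong wedge_cong)

lemma Jop_linear:
  "Jop (\<lambda>i j. A i j + B i j) w j = Jop A w j + Jop B w j"
  "Jop (\<lambda>i j. c * A i j) w j = c * Jop A w j"
  "Jop A (\<lambda>i. v i + w i) j = Jop A v j + Jop A w j"
  "Jop A (\<lambda>i. c * v i) j = c * Jop A v j"
  by (simp_all add: Jop_def sum_distrib_left algebra_simps sum.distrib)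

lemma dot_linear:
  "dot (\<lambda>i. v i + w i) u = dot v u + dot w u" "dot (\<lambda>i. c * v i) u = c * dot v u"
  "dot u (\<lambda>i. v i + w i) = dot u v + dot u w" "dot u (\<lambda>i. c * v i) = c * dot u v"
  by (simp_all add: dot_def sum_distrib_left algebra_simps sum.distrib)

lemma zdot_linear:
  "zdot (\<lambda>i j. A i j + B i j) C = zdot A C + zdot B C" "zdot (\<lambda>i j. c * A i j) C = c * zdot A C"
  "zdot C (\<lambda>i j. A i j + B i j) = zdot C A + zdot C B" "zdot C (\<lambda>i j. c * A i j) = c * zdot C A"
  by (simp_all add: zdot_def sum_distrib_left algebra_simps sum.distrib add_divide_distrib)

text \<open>
  The model \<open>\<real> H \<oplus> \<real>\<^sup>q \<oplus> J\<^sup>\<bottom>\<close>.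
\<close>

definition G :: "(nat \<Rightarrow>\<^sub>0 real) set" where
  "G = {x. x = triple q (hc x) (vc x) (ac x) \<and> zmat (ac x)}"

lemma triple_in_G: "zmat A \<Longrightarrow> triple q h v A \<in> G"
  unfolding G_def by (auto simp: zmat_trunc ac_triple vc_triple intro: triple_cong)

lemma G_eqI:
  assumes "x \<in> G" "y \<in> G" "hc x = hc y" "\<And>i. i < q \<Longrightarrow> vc x i = vc y i"
    "\<And>i j. i < q \<Longrightarrow> j < q \<Longrightarrow> ac x i j = ac y i j"
  shows "x = y"
proof -
  have "x = triple q (hc x) (vc x) (ac x)" "y = triple q (hc y) (vc y) (ac y)"
    using assms(1,2) by (simp_all add: G_def)
  then show ?thesis using assms(3-5) triple_cong by metis
qed

lemma zmat_ac: "x \<in> G \<Longrightarrow> zmat (ac x)" by (simp add: G_def)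

lemma subspace_G: "subspace G"
proof (rule subspaceI)
  show "0 \<in> G" using triple_in_G[OF zmat_0, of 0 "\<lambda>i. 0"] by (simp add: triple_0)
  show "x + y \<in> G" if "x \<in> G" "y \<in> G" for x y
  proof -
    have "x = triple q (hc x) (vc x) (ac x)" "y = triple q (hc y) (vc y) (ac y)"
      using that by (simp_all add: G_def)
    then have "x + y = triple q (hc x + hc y) (\<lambda>i. vc x i + vc y i) (\<lambda>i j. ac x i j + ac y i j)"
      using triple_add by metis
    then show ?thesis using that by (simp add: triple_in_G zmat_add zmat_ac)
  qed
  show "c *\<^sub>R x \<in> G" if "x \<in> G" for x c
  proof -
    have "x = triple q (hc x) (vc x) (ac x)" using that by (simp_all add: G_def)
    then have "c *\<^sub>R x = triple q (c * hc x) (\<lambda>i. c * vc x i) (\<lambda>i j. c * ac x i j)"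
      using triple_scale by metis
    then show ?thesis using that by (simp add: triple_in_G zmat_scale zmat_ac)
  qed
qed

definition eH where "eH = triple q 1 (\<lambda>i. 0) (\<lambda>i j. 0)"
definition eV where "eV i = triple q 0 (kdelta i) (\<lambda>i j. 0)"
definition eZ where "eZ i j = triple q 0 (\<lambda>i. 0) (zframe i j)"

lemma e_in_G: "eH \<in> G" "eV i \<in> G" "eZ i j \<in> G"
  by (simp_all add: eH_def eV_def eZ_def triple_in_G zmat_0 zmat_zframe)

lemma e_coord:
  "hc eH = 1" "vc eH = (\<lambda>i. 0)" "ac eH = (\<lambda>i j. 0)"
  "hc (eV k) = 0" "vc (eV k) = (\<lambda>i. if i < q then kdelta k i else 0)" "ac (eV k) = (\<lambda>i j. 0)"
  "hc (eZ k l) = 0" "vc (eZ k l) = (\<lambda>i. 0)" "ac (eZ k l) = (\<lambda>i j. if i < q \<and> j < q then zframe k l i j else 0)"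
  by (simp_all add: eH_def eV_def eZ_def vc_triple ac_triple fun_eq_iff)

text \<open>
  The three families of frame vectors indexed jointly, in the same way as the positions in \<open>triple\<close>; the
  unused indices \<open>(i + 1, 0)\<close> carry the zero vector.
\<close>

definition frame :: "nat \<times> nat \<Rightarrow> (nat \<Rightarrow>\<^sub>0 real)" where
  "frame s = (case s of (0, 0) \<Rightarrow> eH | (0, Suc i) \<Rightarrow> eV i | (Suc i, 0) \<Rightarrow> 0 | (Suc i, Suc j) \<Rightarrow> eZ i j)"

definition coframe :: "nat \<times> nat \<Rightarrow> (nat \<Rightarrow>\<^sub>0 real) \<Rightarrow> real" where
  "coframe s x = (case s of (0, 0) \<Rightarrow> hc x | (0, Suc i) \<Rightarrow> vc x i | (Suc i, 0) \<Rightarrow> 0 | (Suc i, Suc j) \<Rightarrow> ac x i j / 2)"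

lemma frame_in_G: "frame s \<in> G"
  by (auto simp: frame_def e_in_G subspace_0[OF subspace_G] split: prod.split nat.split)

lemma coframe_linear: "linear_map_on V (coframe s)"
  by (auto simp: linear_map_on_def coframe_def coord_add coord_scale add_divide_distrib
      split: prod.split nat.split)

lemma sum_frame:
  "(\<Sum>s\<in>{..<Suc q} \<times> {..<Suc q}. F s) = F (0,0) + (\<Sum>i<q. F (0, Suc i)) + (\<Sum>i<q. F (Suc i, 0) + (\<Sum>j<q. F (Suc i, Suc j)))"
  for F :: "nat \<times> nat \<Rightarrow> 'b::real_vector"
  unfolding sum.cartesian_product[symmetric, of "\<lambda>i j. F (i, j)", simplified]
  by (simp add: sum.lessThan_Suc_shift del: sum.lessThan_Suc)

lemma frame_expansion:
  assumes "x \<in> G" shows "x = (\<Sum>s\<in>{..<Suc q} \<times> {..<Suc q}. coframe s x *\<^sub>R frame s)"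
proof (rule G_eqI[OF assms])
  show "(\<Sum>s\<in>{..<Suc q} \<times> {..<Suc q}. coframe s x *\<^sub>R frame s) \<in> G"
    by (intro subspace_sum subspace_scale subspace_G frame_in_G)
  show "hc x = hc (\<Sum>s\<in>{..<Suc q} \<times> {..<Suc q}. coframe s x *\<^sub>R frame s)"
    unfolding sum_frame coframe_def frame_def
    by (simp add: coord_add coord_scale coord_sum e_coord)
  show "vc x i = vc (\<Sum>s\<in>{..<Suc q} \<times> {..<Suc q}. coframe s x *\<^sub>R frame s) i" if "i < q" for i
    unfolding sum_frame coframe_def frame_def using that
    by (simp add: coord_add coord_scale coord_sum e_coord)
  show "ac x i j = ac (\<Sum>s\<in>{..<Suc q} \<times> {..<Suc q}. coframe s x *\<^sub>R frame s) i j" if "i < q" "j < q" for i j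
    unfolding sum_frame coframe_def frame_def using that zmat_frame_expansion[OF zmat_ac[OF assms] that]
    by (simp add: coord_add coord_scale coord_sum e_coord)
qed

lemma G_finite_dim: "\<exists>B. finite B \<and> span B = G"
proof (intro exI conjI)
  let ?B = "frame ` ({..<Suc q} \<times> {..<Suc q})"
  show "finite ?B" by simp
  show "span ?B = G"
  proof
    show "span ?B \<subseteq> G" using frame_in_G subspace_G by (intro span_minimal) auto
    show "G \<subseteq> span ?B"
    proof
      fix x assume "x \<in> G"
      then show "x \<in> span ?B"
        by (subst frame_expansion) (auto intro!: span_sum span_scale intro: span_base)
    qed
  qed
qed

lemma trace_on_G:
  assumes "linear_map_on G f" "\<And>x. x \<in> G \<Longrightarrow> f x \<in> G"
  shows "trace_on G f = hc (f eH) + (\<Sum>i<q. vc (f (eV i)) i) + (\<Sum>i<q. \<Sum>j<q. ac (f (eZ i j)) i j) / 2"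
proof -
  have "trace_on G f = (\<Sum>s\<in>{..<Suc q} \<times> {..<Suc q}. coframe s (f (frame s)))"
    using G_finite_dim assms frame_in_G coframe_linear frame_expansion by (rule trace_on_frame)
  then show ?thesis unfolding sum_frame
    by (simp add: coframe_def frame_def sum_divide_distrib)
qed

end

section \<open>The model metric Lie algebra and its Levi-Civita connection\<close>

context soliton
begin

text \<open>
  The normalisation of \<open>ad H\<close>: it makes the Einstein constant on the nilpotent part agree with the soliton
  constant \<open>-1\<close>, as the extension contributes \<open>- tau\<^sup>2 (tr D) D\<close> to the Ricci operator there.
\<close>

definition tau :: real where "tau = 1 / sqrt trace_der"

lemma tau_pos: "tau > 0" using trace_der_pos by (simp add: tau_def)

lemma tau_sq: "tau * tau * trace_der = 1" using trace_der_pos by (simp add: tau_def)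

definition ipG where
  "ipG x y = hc x * hc y + dot (vc x) (vc y) + zdot (ac x) (ac y)"

definition brG where
  "brG x y = triple q 0 (\<lambda>i. tau * d i * (hc x * vc y i - hc y * vc x i))
     (\<lambda>i j. wedge (vc x) (vc y) i j + tau * (d i + d j) * (hc x * ac y i j - hc y * ac x i j))"

text \<open>
  The symmetric form \<open>\<langle>D x, y\<rangle>\<close>, with \<open>D H = 0\<close>.
\<close>

definition derform where
  "derform x y = dot (\<lambda>i. d i * vc x i) (vc y) + zdot (\<lambda>i j. (d i + d j) * ac x i j) (ac y)"

text \<open>
  The solution of the Koszul formula. The operator \<open>ad H\<close> is symmetric, so the derivative along \<open>H\<close> vanishes, and the second fundamental
  form of the nilpotent part is \<open>tau \<langle>D x, y\<rangle>\<close>; the remaining terms are the connection of a two-step nilpotent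
  algebra.
\<close>

definition nablaG where
  "nablaG x y = triple q (tau * derform x y)
     (\<lambda>i. - (Jop (ac x) (vc y) i + Jop (ac y) (vc x) i) / 2 - hc y * tau * d i * vc x i)
     (\<lambda>i j. wedge (vc x) (vc y) i j / 2 - hc y * tau * ((d i + d j) * ac x i j))"

lemmas wedge_linear = wedge_add wedge_scale wedge_add_right wedge_scale_right

lemma derform_linear:
  "derform (x + y) z = derform x z + derform y z" "derform (c *\<^sub>R x) z = c * derform x z"
  "derform z (x + y) = derform z x + derform z y" "derform z (c *\<^sub>R x) = c * derform z x"
proof -
  have l: "(\<lambda>i. d i * (v i + w i)) = (\<lambda>i. d i * v i + d i * w i)"
    "(\<lambda>i. d i * (c * v i)) = (\<lambda>i. c * (d i * v i))"
    "(\<lambda>i j. (d i + d j) * (A i j + B i j)) = (\<lambda>i j. (d i + d j) * A i j + (d i + d j) * B i j)"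
    "(\<lambda>i j. (d i + d j) * (c * A i j)) = (\<lambda>i j. c * ((d i + d j) * A i j))"
    for v w and A B :: "nat \<Rightarrow> nat \<Rightarrow> real"
    by (auto simp: algebra_simps)
  show "derform (x + y) z = derform x z + derform y z" "derform (c *\<^sub>R x) z = c * derform x z"
    "derform z (x + y) = derform z x + derform z y" "derform z (c *\<^sub>R x) = c * derform z x"
    unfolding derform_def coord_add coord_scale l dot_linear zdot_linear
    by (simp_all add: algebra_simps)
qed

lemma brG_linear:
  "brG (x + y) z = brG x z + brG y z" "brG (c *\<^sub>R x) z = c *\<^sub>R brG x z"
  "brG z (x + y) = brG z x + brG z y" "brG z (c *\<^sub>R x) = c *\<^sub>R brG z x"
  unfolding brG_def triple_add triple_scale coord_add coord_scale
  by (rule triple_cong; simp add: wedge_linear algebra_simps)+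

lemma nablaG_linear:
  "nablaG (x + y) z = nablaG x z + nablaG y z" "nablaG (c *\<^sub>R x) z = c *\<^sub>R nablaG x z"
  "nablaG z (x + y) = nablaG z x + nablaG z y" "nablaG z (c *\<^sub>R x) = c *\<^sub>R nablaG z x"
  unfolding nablaG_def derform_linear triple_add triple_scale coord_add coord_scale
  by (rule triple_cong; simp add: wedge_linear Jop_linear add_divide_distrib diff_divide_distrib algebra_simps)+

lemma bilinear_brG: "bilinear_map_on V brG"
  by (simp add: bilinear_map_on_def linear_map_on_def brG_linear)

lemma bilinear_nablaG: "bilinear_map_on V nablaG"
  by (simp add: bilinear_map_on_def linear_map_on_def nablaG_linear)

lemma brG_closed: "x \<in> G \<Longrightarrow> y \<in> G \<Longrightarrow> brG x y \<in> G"
proof -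
  assume "x \<in> G" "y \<in> G"
  then have "zmat (\<lambda>i j. wedge (vc x) (vc y) i j + (d i + d j) * ((tau * hc x) * ac y i j + (- tau * hc y) * ac x i j))"
    by (intro zmat_add zmat_weight zmat_scale zmat_wedge zmat_ac)
  then have "zmat (\<lambda>i j. wedge (vc x) (vc y) i j + tau * (d i + d j) * (hc x * ac y i j - hc y * ac x i j))"
    by (simp add: algebra_simps)
  then show ?thesis unfolding brG_def by (rule triple_in_G)
qed

lemma nablaG_closed: "x \<in> G \<Longrightarrow> y \<in> G \<Longrightarrow> nablaG x y \<in> G"
proof -
  assume "x \<in> G" "y \<in> G"
  then have "zmat (\<lambda>i j. (1/2) * wedge (vc x) (vc y) i j + (- hc y * tau) * ((d i + d j) * ac x i j))"
    by (intro zmat_add zmat_weight zmat_scale zmat_wedge zmat_ac)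
  then have "zmat (\<lambda>i j. wedge (vc x) (vc y) i j / 2 - hc y * tau * ((d i + d j) * ac x i j))"
    by simp
  then show ?thesis unfolding nablaG_def by (rule triple_in_G)
qed

lemma wedge_self: "wedge v v i j = 0"
  using wedge_swap[of v v i j] by simp

lemma brG_coord:
  "hc (brG x y) = 0"
  "i < q \<Longrightarrow> vc (brG x y) i = tau * d i * (hc x * vc y i - hc y * vc x i)"
  "i < q \<Longrightarrow> j < q \<Longrightarrow> ac (brG x y) i j
     = wedge (vc x) (vc y) i j + tau * (d i + d j) * (hc x * ac y i j - hc y * ac x i j)"
  by (simp_all add: brG_def vc_triple ac_triple)

lemma nablaG_coord:
  "hc (nablaG x y) = tau * derform x y"
  "i < q \<Longrightarrow> vc (nablaG x y) i = - (Jop (ac x) (vc y) i + Jop (ac y) (vc x) i) / 2 - hc y * tau * d i * vc x i"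
  "i < q \<Longrightarrow> j < q \<Longrightarrow> ac (nablaG x y) i j
     = wedge (vc x) (vc y) i j / 2 - hc y * tau * ((d i + d j) * ac x i j)"
  by (simp_all add: nablaG_def vc_triple ac_triple)

lemma wedge_brG:
  assumes "i < q" "j < q"
  shows "wedge v (vc (brG x y)) i j = tau * (hc x * wedge v (\<lambda>i. d i * vc y i) i j - hc y * wedge v (\<lambda>i. d i * vc x i) i j)"
proof -
  have "wedge v (vc (brG x y)) i j
    = wedge v (\<lambda>i. (tau * hc x) * (d i * vc y i) + (- tau * hc y) * (d i * vc x i)) i j"
    using assms by (intro wedge_cong) (simp_all add: brG_coord algebra_simps)
  then show ?thesis unfolding wedge_linear by (simp add: algebra_simps)
qed

lemma lie_algebra_G: "lie_algebra G brG"
proof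
  show "\<exists>B. finite B \<and> span B = G" by (rule G_finite_dim)
  show "brG x y \<in> G" if "x \<in> G" "y \<in> G" for x y using that by (rule brG_closed)
  show "bilinear_map_on G brG" by (rule bilinear_brG)
  show "brG x x = 0" for x
    unfolding brG_def triple_0[of q, symmetric] by (rule triple_cong) (simp_all add: wedge_self)
  fix x y z assume G: "x \<in> G" "y \<in> G" "z \<in> G"
  show "brG x (brG y z) + brG y (brG z x) + brG z (brG x y) = 0"
  proof (rule G_eqI)
    show "brG x (brG y z) + brG y (brG z x) + brG z (brG x y) \<in> G"
      by (intro subspace_add[OF subspace_G] brG_closed G)
    show "0 \<in> G" by (rule subspace_0[OF subspace_G])
    show "hc (brG x (brG y z) + brG y (brG z x) + brG z (brG x y)) = hc 0"
      by (simp add: coord_add brG_coord)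
    show "vc (brG x (brG y z) + brG y (brG z x) + brG z (brG x y)) i = vc 0 i" if "i < q" for i
      using that by (simp add: coord_add brG_coord algebra_simps)
    show "ac (brG x (brG y z) + brG y (brG z x) + brG z (brG x y)) i j = ac 0 i j" if ij: "i < q" "j < q" for i j
    proof -
      \<comment> \<open>With these names the identity becomes linear: it only uses that D is a derivation and that the bracket is skew.\<close>
      define W where "W v w = wedge v w i j" for v w
      define W' where "W' v w = wedge v (\<lambda>i. d i * w i) i j" for v w
      define D where "D = d i + d j"
      have 1: "W v (vc (brG x y)) = tau * (hc x * W' v (vc y) - hc y * W' v (vc x))" for v x y
        using wedge_brG[OF ij] by (simp add: W_def W'_def)
      have 2: "W' (vc x) (vc y) = D * W (vc x) (vc y) + W' (vc y) (vc x)" for x y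
        using wedge_derivation[of "vc x" "vc y" i j] wedge_swap[of "\<lambda>i. d i * vc x i" "vc y" i j]
        by (simp add: W_def W'_def D_def)
      have 3: "W (vc z) (vc x) = - W (vc x) (vc z)" for x z
        using wedge_swap[of "vc z" "vc x" i j] by (simp add: W_def)
      show ?thesis
        using ij by (simp add: coord_add brG_coord 1 flip: W_def D_def)
          (simp add: 2[of x y] 2[of x z] 2[of y z] 3[of z x] algebra_simps)
    qed
  qed
qed

lemma linear_ipG: "linear_map_on V (ipG x)" "linear_map_on V (\<lambda>x. ipG x y)"
  by (simp_all add: linear_map_on_def ipG_def coord_add coord_scale dot_linear zdot_linear algebra_simps)

lemma inner_product_G: "inner_product_on G ipG"
  unfolding inner_product_on_def
proof (intro conjI ballI impI)
  show "bilinear_map_on G ipG" by (simp add: bilinear_map_on_def linear_ipG)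
  show "ipG x y = ipG y x" for x y by (simp add: ipG_def dot_def zdot_def mult.commute)
  fix x assume x: "x \<in> G" "x \<noteq> 0"
  have n: "dot (vc x) (vc x) \<ge> 0" "zdot (ac x) (ac x) \<ge> 0" "hc x * hc x \<ge> 0"
    by (simp_all add: dot_def zdot_def sum_nonneg)
  show "ipG x x > 0"
  proof (rule ccontr)
    assume "\<not> ipG x x > 0"
    then have 0: "hc x * hc x = 0" "dot (vc x) (vc x) = 0" "zdot (ac x) (ac x) = 0"
      using n unfolding ipG_def by linarith+
    have v: "vc x i = 0" if "i < q" for i
      using 0(2) that by (simp add: dot_def sum_nonneg_eq_0_iff)
    have a: "ac x i j = 0" if "i < q" "j < q" for i j
      using 0(3) that by (simp add: zdot_def sum_nonneg_eq_0_iff sum_nonneg)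
    have "x = 0"
      using v a 0(1) x(1) subspace_0[OF subspace_G] by (intro G_eqI) simp_all
    then show False using x by simp
  qed
qed

lemma derform_sym: "derform x y = derform y x"
  by (simp add: derform_def dot_def zdot_def mult_ac)

lemma dot_cong: "(\<And>i. i < q \<Longrightarrow> v i = v' i) \<Longrightarrow> (\<And>i. i < q \<Longrightarrow> w i = w' i) \<Longrightarrow> dot v w = dot v' w'"
  by (simp add: dot_def)

lemma zdot_cong: "(\<And>i j. i < q \<Longrightarrow> j < q \<Longrightarrow> A i j = A' i j) \<Longrightarrow> (\<And>i j. i < q \<Longrightarrow> j < q \<Longrightarrow> B i j = B' i j)
   \<Longrightarrow> zdot A B = zdot A' B'"
  by (simp add: zdot_def)

lemma dot_commute: "dot v w = dot w v" by (simp add: dot_def mult.commute)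

lemma ipG_nablaG:
  assumes "x \<in> G" "y \<in> G" "z \<in> G"
  shows "ipG (nablaG x y) z = tau * derform x y * hc z - tau * derform x z * hc y
    - dot (Jop (ac x) (vc y)) (vc z) / 2
    - zdot (ac y) (wedge (vc x) (vc z)) / 2 + zdot (ac z) (wedge (vc x) (vc y)) / 2"
proof -
  have "dot (vc (nablaG x y)) (vc z) = dot (\<lambda>i. (- 1/2) * Jop (ac x) (vc y) i +
     ((- 1/2) * Jop (ac y) (vc x) i + (- hc y * tau) * (d i * vc x i))) (vc z)"
    by (rule dot_cong) (simp_all add: nablaG_coord)
  also have "\<dots> = - dot (Jop (ac x) (vc y)) (vc z) / 2 - zdot (ac y) (wedge (vc x) (vc z)) / 2
     - hc y * tau * dot (\<lambda>i. d i * vc x i) (vc z)"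
    unfolding dot_linear using Jop_adjoint[OF zmat_ac[OF assms(2)]] by simp
  finally have 1: "dot (vc (nablaG x y)) (vc z) = \<dots>" .
  have "zdot (ac (nablaG x y)) (ac z) = zdot (\<lambda>i j. (1/2) * wedge (vc x) (vc y) i j +
     (- hc y * tau) * ((d i + d j) * ac x i j)) (ac z)"
    by (rule zdot_cong) (simp_all add: nablaG_coord)
  also have "\<dots> = zdot (ac z) (wedge (vc x) (vc y)) / 2 - hc y * tau * zdot (\<lambda>i j. (d i + d j) * ac x i j) (ac z)"
    unfolding zdot_linear by (simp add: zdot_commute)
  finally have 2: "zdot (ac (nablaG x y)) (ac z) = \<dots>" .
  show ?thesis unfolding ipG_def 1 2 nablaG_coord by (simp add: derform_def algebra_simps)
qed

lemma levi_civita_G: "levi_civita G brG ipG nablaG"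
  unfolding levi_civita_def
proof (intro conjI ballI)
  show "bilinear_map_on G nablaG" by (rule bilinear_nablaG)
  fix x y assume G: "x \<in> G" "y \<in> G"
  show "nablaG x y \<in> G" using G by (rule nablaG_closed)
  have "nablaG x y = brG x y + nablaG y x"
  proof (rule G_eqI)
    show "nablaG x y \<in> G" "brG x y + nablaG y x \<in> G"
      using G by (auto intro!: nablaG_closed brG_closed subspace_add[OF subspace_G])
    show "hc (nablaG x y) = hc (brG x y + nablaG y x)"
      by (simp add: coord_add brG_coord nablaG_coord derform_sym[of x y])
    show "vc (nablaG x y) i = vc (brG x y + nablaG y x) i" if "i < q" for i
      using that by (simp add: coord_add brG_coord nablaG_coord algebra_simps)
    show "ac (nablaG x y) i j = ac (brG x y + nablaG y x) i j" if "i < q" "j < q" for i j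
      using that wedge_swap[of "vc x" "vc y" i j] by (simp add: coord_add brG_coord nablaG_coord algebra_simps)
  qed
  then show "nablaG x y - nablaG y x = brG x y" by simp
  fix z assume z: "z \<in> G"
  have "ipG y (nablaG x z) = ipG (nablaG x z) y"
    by (simp add: ipG_def dot_commute[of "vc y"] zdot_commute[of "ac y"])
  then show "ipG (nablaG x y) z + ipG y (nablaG x z) = 0"
    using Jop_skew[OF zmat_ac[OF G(1)], of "vc y" "vc z"]
    by (simp add: ipG_nablaG G z)
qed

end

section \<open>Ricci curvature and nilradical of the model\<close>

lemma coord_diff:
  "hc (x - y) = hc x - hc y" "vc (x - y) = (\<lambda>i. vc x i - vc y i)" "ac (x - y) = (\<lambda>i j. ac x i j - ac y i j)"
  by (simp_all add: hc_def vc_def ac_def lookup_minus fun_eq_iff)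

lemma hc_uminus: "hc (- x) = - hc x" by (simp add: hc_def)

context soliton
begin

lemma Jop_kdelta: "Jop A (kdelta i) j = (if i < q then sg i j * A i j else 0)"
  by (simp add: Jop_def)

lemma Jop_eV: "Jop A (vc (eV i)) j = (if i < q then sg i j * A i j else 0)"
  by (simp add: e_coord trunc_simps Jop_kdelta)

lemma Jop_0: "Jop (\<lambda>i j. 0) w j = 0" "Jop A (\<lambda>i. 0) j = 0"
  by (simp_all add: Jop_def)

lemma Jop_cong: "(\<And>i. i < q \<Longrightarrow> A i j = A' i j) \<Longrightarrow> (\<And>i. i < q \<Longrightarrow> w i = w' i) \<Longrightarrow> Jop A w j = Jop A' w' j"
  by (simp add: Jop_def)

lemma wedge_0: "wedge (\<lambda>i. 0) w i j = 0" "wedge w (\<lambda>i. 0) i j = 0"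
  using wedge_scale[of 0 "\<lambda>i. 0" w i j] wedge_scale_right[of w 0 "\<lambda>i. 0" i j] by simp_all

lemma dot_0: "dot (\<lambda>i. 0) w = 0" "dot w (\<lambda>i. 0) = 0" by (simp_all add: dot_def)
lemma zdot_0: "zdot (\<lambda>i j. 0) w = 0" "zdot w (\<lambda>i j. 0) = 0" by (simp_all add: zdot_def)

lemma zmat_diag: "zmat A \<Longrightarrow> A i i = 0"
  using zmat_skew[of A i i] by simp

lemma nablaG_eH: "nablaG eH y = 0"
  unfolding nablaG_def triple_0[of q, symmetric]
  by (rule triple_cong) (simp_all add: derform_def e_coord dot_0 zdot_0 Jop_0 wedge_0)

lemma nablaG_0: "nablaG y 0 = 0"
  using nablaG_linear(4)[of y 0 0] by simp

text \<open>
  The forms \<open>\<langle>D\<^sup>2 x, y\<rangle>\<close> on \<open>v\<close> and on the centre, and the two forms that make up the Ricci form of the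
  nilpotent part: \<open>- casimir_form / 2\<close> on \<open>v\<close> and \<open>sgform / 4\<close> on the centre.
\<close>

definition dsq where "dsq x y = dot (\<lambda>i. d i * d i * vc x i) (vc y)"
definition zsq where "zsq x y = zdot (\<lambda>i j. (d i + d j) * (d i + d j) * ac x i j) (ac y)"
definition casimir_form where "casimir_form x y = (\<Sum>k<q. casimir k * (vc x k * vc y k))"
definition sgform where "sgform x y = (\<Sum>i<q. \<Sum>j<q. sg i j * sg i j * ac x i j * ac y i j)"

text \<open>
  The trace of \<open>x \<mapsto> R(x, y) z\<close> is the sum of its diagonal blocks along \<open>H\<close>, \<open>v\<close> and the centre. The terms in
  \<open>dsq\<close> and \<open>zsq\<close> of this block cancel against those of the other two.
\<close>

lemma curvature_eH: "hc (curvature brG nablaG eH y z) = - tau * tau * (dsq y z + zsq y z)"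
proof -
  have "dot (\<lambda>i. d i * vc (brG eH y) i) (vc z) = tau * dsq y z"
    unfolding dsq_def dot_linear(2)[symmetric] by (rule dot_cong) (simp_all add: brG_coord e_coord)
  moreover have "zdot (\<lambda>i j. (d i + d j) * ac (brG eH y) i j) (ac z) = tau * zsq y z"
    unfolding zsq_def zdot_linear(2)[symmetric] by (rule zdot_cong) (simp_all add: brG_coord e_coord wedge_0)
  ultimately show ?thesis
    by (simp add: curvature_def nablaG_eH nablaG_0 coord_diff hc_uminus nablaG_coord derform_def algebra_simps)
qed

lemma trace_V_nabla:
  assumes "y \<in> G" shows "(\<Sum>i<q. vc (nablaG (eV i) y) i) = - hc y * tau * (\<Sum>i<q. d i)"
  unfolding sum_distrib_left
  by (intro sum.cong refl) (simp add: nablaG_coord Jop_kdelta trunc_simps e_coord Jop_0 zmat_diag[OF zmat_ac[OF assms]])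

lemma trace_V_nabla_nabla:
  assumes "y \<in> G" "z \<in> G"
  shows "(\<Sum>i<q. vc (nablaG y (nablaG (eV i) z)) i)
    = - sgform y z / 4 + casimir_form y z / 4 - tau * tau * dsq y z"
proof -
  have "(\<Sum>i<q. vc (nablaG y (nablaG (eV i) z)) i) = (\<Sum>i<q. - (\<Sum>k<q. sg i k * sg i k * ac y i k * ac z i k) / 4
     - Jop (wedge (kdelta i) (vc z)) (vc y) i / 4 - tau * tau * (d i * d i * vc y i * vc z i))"
  proof (intro sum.cong refl)
    fix i assume "i \<in> {..<q}"
    then have i: "i < q" by simp
    let ?N = "nablaG (eV i) z"
    have "Jop (ac y) (vc ?N) i = (\<Sum>k<q. sg i k * sg i k * ac y i k * ac z i k / 2)"
      unfolding Jop_def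
    proof (intro sum.cong refl)
      fix k assume "k \<in> {..<q}"
      then show "sg k i * ac y k i * vc ?N k = sg i k * sg i k * ac y i k * ac z i k / 2"
        using i zmat_diag[OF zmat_ac[OF assms(1)], of i] zmat_skew[OF zmat_ac[OF assms(1)], of k i] sg_sym[of k i]
        by (cases "i = k") (simp_all add: nablaG_coord Jop_kdelta trunc_simps e_coord Jop_0)
    qed
    then have X: "Jop (ac y) (vc ?N) i = (\<Sum>k<q. sg i k * sg i k * ac y i k * ac z i k) / 2"
      by (simp add: sum_divide_distrib)
    have "Jop (ac ?N) (vc y) i = Jop (\<lambda>k l. (1/2) * wedge (kdelta i) (vc z) k l) (vc y) i"
      using i by (intro Jop_cong) (simp_all add: nablaG_coord e_coord trunc_simps)
    then have Y: "Jop (ac ?N) (vc y) i = Jop (wedge (kdelta i) (vc z)) (vc y) i / 2"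
      unfolding Jop_linear by simp
    have H: "derform (eV i) z = d i * vc z i"
    proof -
      have "dot (\<lambda>k. d k * vc (eV i) k) (vc z) = (\<Sum>k<q. (d k * vc z k) * kdelta i k)"
        unfolding dot_def e_coord by (intro sum.cong) auto
      then show ?thesis using i by (simp add: derform_def e_coord zdot_0)
    qed
    show "vc (nablaG y ?N) i = - (\<Sum>k<q. sg i k * sg i k * ac y i k * ac z i k) / 4
     - Jop (wedge (kdelta i) (vc z)) (vc y) i / 4 - tau * tau * (d i * d i * vc y i * vc z i)"
      unfolding nablaG_coord(2)[OF i] X Y nablaG_coord(1) H by (simp add: field_simps)
  qed
  also have "\<dots> = - sgform y z / 4 + casimir_form y z / 4 - tau * tau * dsq y z"
    using Jop_wedge_sum[of "vc z" "vc y"]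
    by (simp add: sum_subtractf sum_negf sgform_def casimir_form_def dsq_def dot_def sum_distrib_left mult_ac
        flip: sum_divide_distrib)
  finally show ?thesis .
qed

lemma trace_V_nabla_bracket:
  assumes "y \<in> G" "z \<in> G"
  shows "(\<Sum>i<q. vc (nablaG (brG (eV i) y) z) i)
    = casimir_form y z / 2 + hc y * hc z * tau * tau * (\<Sum>i<q. d i * d i)"
proof -
  have "(\<Sum>i<q. vc (nablaG (brG (eV i) y) z) i) = (\<Sum>i<q. - Jop (wedge (kdelta i) (vc y)) (vc z) i / 2
     + hc y * hc z * tau * tau * (d i * d i))"
  proof (intro sum.cong refl)
    fix i assume "i \<in> {..<q}"
    then have i: "i < q" by simp
    let ?N = "brG (eV i) y"
    have "Jop (ac ?N) (vc z) i = Jop (wedge (kdelta i) (vc y)) (vc z) i"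
      using i by (intro Jop_cong) (simp_all add: brG_coord e_coord trunc_simps)
    moreover have "Jop (ac z) (vc ?N) i = Jop (ac z) (\<lambda>k. - (tau * d i * hc y) * vc (eV i) k) i"
      by (intro Jop_cong refl) (auto simp add: brG_coord e_coord kdelta_def)
    moreover have "\<dots> = 0" using i zmat_diag[OF zmat_ac[OF assms(2)], of i]
      unfolding Jop_linear Jop_eV by simp
    ultimately show "vc (nablaG ?N z) i = - Jop (wedge (kdelta i) (vc y)) (vc z) i / 2
     + hc y * hc z * tau * tau * (d i * d i)"
      using i by (simp add: nablaG_coord brG_coord e_coord kdelta_def)
  qed
  also have "\<dots> = casimir_form y z / 2 + hc y * hc z * tau * tau * (\<Sum>i<q. d i * d i)"
    using Jop_wedge_sum[of "vc y" "vc z"]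
    by (simp add: sum.distrib sum_subtractf sum_negf casimir_form_def sum_distrib_left mult_ac flip: sum_divide_distrib)
  finally show ?thesis .
qed

lemma trace_Z_nabla:
  "(\<Sum>i<q. \<Sum>j<q. ac (nablaG (eZ i j) y) i j) = - hc y * tau * (\<Sum>i<q. \<Sum>j<q. (d i + d j) * zframe i j i j)"
  unfolding sum_distrib_left
  by (intro sum.cong refl) (simp add: nablaG_coord e_coord wedge_0)

lemma trace_Z_nabla_bracket:
  "(\<Sum>i<q. \<Sum>j<q. ac (nablaG (brG (eZ i j) y) z) i j)
    = hc y * hc z * tau * tau * (\<Sum>i<q. \<Sum>j<q. (d i + d j) * (d i + d j) * zframe i j i j)"
  unfolding sum_distrib_left
proof (intro sum.cong refl)
  fix i j assume ij: "i \<in> {..<q}" "j \<in> {..<q}"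
  have "wedge (vc (brG (eZ i j) y)) (vc z) i j = wedge (\<lambda>i. 0) (vc z) i j"
    using ij by (intro wedge_cong) (simp_all add: brG_coord e_coord)
  then show "ac (nablaG (brG (eZ i j) y) z) i j
    = hc y * hc z * tau * tau * ((d i + d j) * (d i + d j) * zframe i j i j)"
    using ij by (simp add: nablaG_coord brG_coord e_coord wedge_0)
qed

text \<open>
  By adjointness, the trace over the centre of \<open>A \<mapsto> [v, Jop A w]\<close> equals \<open>\<Sum> \<langle>[v, e l], [w, e l]\<rangle>\<close>, a sum over
  \<open>v\<close> that \<open>Jop_wedge_sum\<close> evaluates.
\<close>

lemma wedge_Jop_trace:
  "(\<Sum>i<q. \<Sum>j<q. wedge v (Jop (zframe i j) w) i j) / 2 = (\<Sum>k<q. casimir k * (v k * w k))"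
proof -
  have J: "Jop (zframe i j) v l = wedge v (kdelta l) i j" if "i < q" "j < q" "l < q" for i j l v
  proof -
    have "Jop (zframe i j) v l = dot (Jop (zframe i j) v) (kdelta l)"
      using that by (simp add: dot_def)
    also have "\<dots> = zdot (wedge v (kdelta l)) (zframe i j)"
      by (simp add: Jop_adjoint[OF zmat_zframe] zdot_commute)
    finally show ?thesis using zdot_zframe[OF zmat_wedge] that by simp
  qed
  have "(\<Sum>i<q. \<Sum>j<q. wedge v (Jop (zframe i j) w) i j)
    = (\<Sum>i<q. \<Sum>j<q. \<Sum>l<q. wedge v (kdelta l) i j * wedge w (kdelta l) i j)"
  proof (intro sum.cong refl)
    fix i j assume ij: "i \<in> {..<q}" "j \<in> {..<q}"
    have "wedge v (Jop (zframe i j) w) i j = zdot (wedge v (Jop (zframe i j) w)) (zframe i j)"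
      using ij zdot_zframe[OF zmat_wedge] by simp
    also have "\<dots> = dot (Jop (zframe i j) v) (Jop (zframe i j) w)"
      by (simp add: Jop_adjoint[OF zmat_zframe] zdot_commute)
    also have "\<dots> = (\<Sum>l<q. wedge v (kdelta l) i j * wedge w (kdelta l) i j)"
      unfolding dot_def using ij by (intro sum.cong refl) (simp add: J)
    finally show "wedge v (Jop (zframe i j) w) i j = (\<Sum>l<q. wedge v (kdelta l) i j * wedge w (kdelta l) i j)" .
  qed
  also have "\<dots> = (\<Sum>i<q. \<Sum>l<q. \<Sum>j<q. wedge v (kdelta l) i j * wedge w (kdelta l) i j)"
    by (rule sum.cong[OF refl], rule sum.swap)
  also have "\<dots> = (\<Sum>l<q. \<Sum>i<q. \<Sum>j<q. wedge v (kdelta l) i j * wedge w (kdelta l) i j)"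
    by (rule sum.swap)
  also have "\<dots> = (\<Sum>l<q. 2 * zdot (wedge v (kdelta l)) (wedge w (kdelta l)))"
    by (simp add: zdot_def)
  also have "\<dots> = (\<Sum>l<q. - 2 * Jop (wedge (kdelta l) v) w l)"
  proof (intro sum.cong refl)
    fix l assume l: "l \<in> {..<q}"
    have "zdot (wedge v (kdelta l)) (wedge w (kdelta l)) = dot (Jop (wedge v (kdelta l)) w) (kdelta l)"
      by (simp add: Jop_adjoint[OF zmat_wedge])
    also have "\<dots> = Jop (wedge v (kdelta l)) w l" using l by (simp add: dot_def)
    also have "\<dots> = Jop (\<lambda>i j. - 1 * wedge (kdelta l) v i j) w l"
      by (intro Jop_cong) (simp_all add: wedge_swap[of v])
    finally show "2 * zdot (wedge v (kdelta l)) (wedge w (kdelta l)) = - 2 * Jop (wedge (kdelta l) v) w l"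
      unfolding Jop_linear by simp
  qed
  finally show ?thesis using Jop_wedge_sum[of v w] by (simp add: sum_distrib_left[symmetric] sum_negf mult_ac)
qed

lemma trace_Z_nabla_nabla:
  assumes "y \<in> G" "z \<in> G"
  shows "(\<Sum>i<q. \<Sum>j<q. ac (nablaG y (nablaG (eZ i j) z)) i j) / 2
    = - casimir_form y z / 4 - tau * tau * zsq y z"
proof -
  have "(\<Sum>i<q. \<Sum>j<q. ac (nablaG y (nablaG (eZ i j) z)) i j)
    = (\<Sum>i<q. \<Sum>j<q. - 1 / 4 * wedge (vc y) (Jop (zframe i j) (vc z)) i j
       - tau * tau * ((d i + d j) * (d i + d j) * ac y i j * ac z i j))"
  proof (intro sum.cong refl)
    fix i j assume "i \<in> {..<q}" "j \<in> {..<q}"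
    then have ij: "i < q" "j < q" by auto
    let ?N = "nablaG (eZ i j) z"
    have "wedge (vc y) (vc ?N) i j = wedge (vc y) (\<lambda>k. - 1 / 2 * Jop (zframe i j) (vc z) k) i j"
      using ij by (intro wedge_cong) (simp_all add: nablaG_coord e_coord Jop_0 trunc_simps)
    moreover have "derform (eZ i j) z = (d i + d j) * ac z i j"
    proof -
      have "derform (eZ i j) z = derform z (eZ i j)" by (rule derform_sym)
      also have "\<dots> = zdot (\<lambda>i j. (d i + d j) * ac z i j) (zframe i j)"
        by (simp add: derform_def e_coord dot_0 trunc_simps)
      also have "\<dots> = (d i + d j) * ac z i j"
        by (rule zdot_zframe[OF zmat_weight[OF zmat_ac[OF assms(2)]] ij])
      finally show ?thesis .
    qed
    ultimately show "ac (nablaG y ?N) i j = - 1 / 4 * wedge (vc y) (Jop (zframe i j) (vc z)) i j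
       - tau * tau * ((d i + d j) * (d i + d j) * ac y i j * ac z i j)"
      using ij unfolding wedge_linear by (simp add: nablaG_coord)
  qed
  also have "\<dots> = - 1 / 4 * (\<Sum>i<q. \<Sum>j<q. wedge (vc y) (Jop (zframe i j) (vc z)) i j) - tau * tau * (2 * zsq y z)"
    by (simp only: sum_subtractf sum_distrib_left[symmetric] zsq_def zdot_def)
  finally show ?thesis using wedge_Jop_trace[of "vc y" "vc z"] by (simp add: casimir_form_def)
qed

text \<open>
  Adding the blocks, the Ricci form is \<open>- tau\<^sup>2 (tr D) \<langle>D y, z\<rangle>\<close> plus the Ricci form of the nilpotent part
  plus \<open>- tau\<^sup>2 tr D\<^sup>2\<close> in the direction \<open>H\<close>. With \<open>tau\<^sup>2 tr D = 1\<close> the soliton equations turn this into minus the inner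
  product.
\<close>

lemma ricci_G:
  assumes y: "y \<in> G" and z: "z \<in> G"
  shows "ricci G brG nablaG y z = - ipG y z"
proof -
  let ?R = "\<lambda>x. curvature brG nablaG x y z"
  have lin: "linear_map_on G ?R"
    by (simp add: linear_map_on_def curvature_def nablaG_linear brG_linear scaleR_diff_right)
  have closed: "?R x \<in> G" if "x \<in> G" for x
    unfolding curvature_def using that y z
    by (intro subspace_diff[OF subspace_G] nablaG_closed brG_closed)
  define T1 where "T1 = (\<Sum>i<q. \<Sum>j<q. (d i + d j) * zframe i j i j)"
  define T2 where "T2 = (\<Sum>i<q. \<Sum>j<q. (d i + d j) * (d i + d j) * zframe i j i j)"
  have yz: "nablaG y z \<in> G" using y z by (rule nablaG_closed)
  have V: "(\<Sum>i<q. vc (?R (eV i)) i) = - tau * derform y z * tau * (\<Sum>i<q. d i) - (- sgform y z / 4 + casimir_form y z / 4 - tau * tau * dsq y z)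
     - (casimir_form y z / 2 + hc y * hc z * tau * tau * (\<Sum>i<q. d i * d i))"
    unfolding curvature_def coord_diff sum_subtractf trace_V_nabla[OF yz] trace_V_nabla_nabla[OF y z] trace_V_nabla_bracket[OF y z] nablaG_coord by simp
  have Z2: "(\<Sum>i<q. \<Sum>j<q. ac (nablaG y (nablaG (eZ i j) z)) i j) = 2 * (- casimir_form y z / 4 - tau * tau * zsq y z)"
    using trace_Z_nabla_nabla[OF y z] by simp
  have Z: "(\<Sum>i<q. \<Sum>j<q. ac (?R (eZ i j)) i j) = - tau * derform y z * tau * T1 - 2 * (- casimir_form y z / 4 - tau * tau * zsq y z)
     - hc y * hc z * tau * tau * T2"
    unfolding curvature_def coord_diff sum_subtractf trace_Z_nabla Z2 trace_Z_nabla_bracket nablaG_coord T1_def T2_def by simp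
  have tr: "trace_der = (\<Sum>i<q. d i) + T1 / 2" "trace_der = (\<Sum>i<q. d i * d i) + T2 / 2"
    using trace_der_eq_trace_der_sq by (simp_all add: trace_der_def trace_der_sq_def T1_def T2_def)
  have T: "trace_on G ?R = hc (?R eH) + (\<Sum>i<q. vc (?R (eV i)) i) + (\<Sum>i<q. \<Sum>j<q. ac (?R (eZ i j)) i j) / 2"
    by (rule trace_on_G[OF lin closed])
  define D1 where "D1 = (\<Sum>i<q. d i)"
  define D2 where "D2 = (\<Sum>i<q. d i * d i)"
  have "ricci G brG nablaG y z = - (tau * tau * (D1 + T1 / 2)) * derform y z + sgform y z / 4 - casimir_form y z / 2
      - hc y * hc z * (tau * tau * (D2 + T2 / 2))"
    unfolding ricci_def T curvature_eH V Z D1_def[symmetric] D2_def[symmetric]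
    by (simp add: field_simps)
  also have "\<dots> = - (tau * tau * trace_der) * derform y z + sgform y z / 4 - casimir_form y z / 2
      - hc y * hc z * (tau * tau * trace_der)"
    unfolding D1_def D2_def tr(1)[symmetric] tr(2)[symmetric] by simp
  also have "\<dots> = - derform y z + sgform y z / 4 - casimir_form y z / 2 - hc y * hc z"
    by (simp add: tau_sq)
  also have "\<dots> = - ipG y z"
  proof -
    have "dot (\<lambda>i. d i * vc y i) (vc z) + casimir_form y z / 2 = dot (vc y) (vc z)"
      unfolding dot_def casimir_form_def sum_divide_distrib sum.distrib[symmetric]
    proof (intro sum.cong refl)
      fix i assume "i \<in> {..<q}"
      then have c: "casimir i = 2 - 2 * d i" using einstein_v[of i] by simp
      show "d i * vc y i * vc z i + casimir i * (vc y i * vc z i) / 2 = vc y i * vc z i"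
        unfolding c by (simp add: field_simps)
    qed
    moreover have "zdot (\<lambda>i j. (d i + d j) * ac y i j) (ac z) - sgform y z / 4 = zdot (ac y) (ac z)"
      unfolding zdot_def sgform_def sum_divide_distrib sum_subtractf[symmetric]
      by (intro sum.cong refl) (simp add: sg_sq algebra_simps add_divide_distrib diff_divide_distrib)
    ultimately show ?thesis by (simp add: ipG_def derform_def)
  qed
  finally show ?thesis .
qed

lemma trace_ad_eH: "trace_on G (brG eH) = tau * trace_der"
proof -
  have "trace_on G (brG eH) = hc (brG eH eH) + (\<Sum>i<q. vc (brG eH (eV i)) i) + (\<Sum>i<q. \<Sum>j<q. ac (brG eH (eZ i j)) i j) / 2"
    using e_in_G(1) by (intro trace_on_G brG_closed) (simp add: linear_map_on_def brG_linear)
  also have "\<dots> = tau * trace_der"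
    by (simp add: brG_coord e_coord wedge_0 trace_der_def algebra_simps sum_distrib_left sum_distrib_right)
  finally show ?thesis .
qed

definition N where "N = {x \<in> G. hc x = 0}"
definition Z where "Z = {x \<in> G. hc x = 0 \<and> (\<forall>i<q. vc x i = 0)}"

lemma subspace_N: "subspace N" and subspace_Z: "subspace Z"
  using subspace_G unfolding N_def Z_def subspace_def by (auto simp: coord_add coord_scale)

lemma bracket_span_least:
  "subspace W \<Longrightarrow> (\<And>x y. x \<in> A \<Longrightarrow> y \<in> B \<Longrightarrow> br x y \<in> W) \<Longrightarrow> bracket_span br A B \<subseteq> W"
  unfolding bracket_span_def by (rule span_minimal) auto

lemma zero_in_bracket_span: "0 \<in> bracket_span br A B"
  unfolding bracket_span_def by (rule span_zero)

lemma brG_in_N: "x \<in> G \<Longrightarrow> y \<in> G \<Longrightarrow> brG x y \<in> N"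
  by (simp add: N_def brG_closed brG_coord)

lemma brG_in_Z: "x \<in> N \<Longrightarrow> y \<in> N \<Longrightarrow> brG x y \<in> Z"
  by (simp add: N_def Z_def brG_closed brG_coord)

lemma brG_N_Z: "x \<in> N \<Longrightarrow> y \<in> Z \<Longrightarrow> brG x y = 0"
proof (rule G_eqI)
  assume x: "x \<in> N" and y: "y \<in> Z"
  show "brG x y \<in> G" using x y by (simp add: N_def Z_def brG_closed)
  show "ac (brG x y) i j = ac 0 i j" if "i < q" "j < q" for i j
  proof -
    have "wedge (vc x) (vc y) i j = wedge (vc x) (\<lambda>i. 0) i j"
      using y that by (intro wedge_cong) (auto simp: Z_def)
    then show ?thesis using that x y by (simp add: brG_coord N_def Z_def wedge_0)
  qed
qed (auto simp: brG_coord N_def Z_def subspace_0[OF subspace_G])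

lemma Z_sub_N: "Z \<subseteq> N" by (auto simp: N_def Z_def)

lemma nilpotent_N: "nilpotent_lie N brG"
proof -
  have "lower_central_series N brG 1 \<subseteq> Z"
    by (simp add: bracket_span_least[OF subspace_Z] brG_in_Z)
  then have "lower_central_series N brG 2 \<subseteq> {0}"
    unfolding numeral_2_eq_2 lower_central_series.simps
    by (intro bracket_span_least) (auto simp: brG_N_Z)
  moreover have "0 \<in> lower_central_series N brG 2"
    by (simp add: numeral_2_eq_2 zero_in_bracket_span)
  ultimately show ?thesis unfolding nilpotent_lie_def by blast
qed

lemma solvable_G: "solvable_lie G brG"
proof -
  have 1: "derived_series G brG 1 \<subseteq> N"
    by (simp add: bracket_span_least[OF subspace_N] brG_in_N)
  have 2: "derived_series G brG 2 \<subseteq> Z"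
    using 1 unfolding numeral_2_eq_2 derived_series.simps(2)[of _ _ "Suc 0"]
    by (intro bracket_span_least[OF subspace_Z] brG_in_Z) auto
  have "derived_series G brG 3 \<subseteq> {0}"
    using 2 unfolding numeral_3_eq_3 derived_series.simps(2)[of _ _ "Suc (Suc 0)"]
    by (intro bracket_span_least) (use Z_sub_N in \<open>auto simp: brG_N_Z numeral_2_eq_2 subset_iff\<close>)
  moreover have "0 \<in> derived_series G brG 3"
    by (simp add: numeral_3_eq_3 zero_in_bracket_span)
  ultimately show ?thesis unfolding solvable_lie_def by blast
qed

text \<open>
  An ideal containing an element \<open>u\<close> with nonzero \<open>H\<close>-component is not nilpotent: modulo the centre, \<open>ad u\<close>
  multiplies the \<open>i\<close>-th coordinate of an element of \<open>N\<close> by a nonzero number, so the lower central series of the ideal never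
  vanishes.
\<close>

lemma nilradical_N: "is_nilradical G brG N"
  unfolding is_nilradical_def
proof (intro conjI allI impI)
  show "lie_ideal G brG N"
    unfolding lie_ideal_def using subspace_N brG_in_N by (auto simp: N_def)
  show "nilpotent_lie N brG" by (rule nilpotent_N)
  fix I assume I: "lie_ideal G brG I \<and> nilpotent_lie I brG"
  show "I \<subseteq> N"
  proof (rule ccontr)
    assume "\<not> I \<subseteq> N"
    then obtain u where u: "u \<in> I" "hc u \<noteq> 0" "u \<in> G"
      using I unfolding lie_ideal_def N_def by blast
    obtain i where i: "i < q" using S_nonempty S_sub by blast
    have td: "tau * d i \<noteq> 0" using tau_pos d_ge[of i] by simp
    have "\<exists>y. y \<in> lower_central_series I brG k \<and> hc y = 0 \<and> vc y i \<noteq> 0" for k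
    proof (induction k)
      case 0
      have "brG (eV i) u \<in> I" using I u e_in_G unfolding lie_ideal_def by blast
      then show ?case using i td u
        by (intro exI[of _ "brG (eV i) u"]) (simp add: brG_coord e_coord kdelta_def)
    next
      case (Suc k)
      then obtain y where y: "y \<in> lower_central_series I brG k" "hc y = 0" "vc y i \<noteq> 0" by blast
      have "brG u y \<in> lower_central_series I brG (Suc k)"
        using u y by (auto simp: bracket_span_def intro: span_base)
      then show ?case using i td u y
        by (intro exI[of _ "brG u y"]) (simp add: brG_coord)
    qed
    moreover obtain k where "lower_central_series I brG k = {0}"
      using I unfolding nilpotent_lie_def by blast
    ultimately obtain y where "y \<in> {0}" "vc y i \<noteq> 0" by metis
    then show False by simp
  qed
qed

lemma einstein_G: "einstein_metric_solvable G brG ipG"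
  unfolding einstein_metric_solvable_def
proof (intro conjI exI)
  show "lie_algebra G brG" "solvable_lie G brG" "inner_product_on G ipG" "levi_civita G brG ipG nablaG"
    by (rule lie_algebra_G solvable_G inner_product_G levi_civita_G)+
  show "\<not> unimodular G brG"
    unfolding unimodular_def using trace_ad_eH tau_pos trace_der_pos e_in_G(1)
    by (metis mult_pos_pos less_irrefl)
  show "\<forall>x\<in>G. \<forall>y\<in>G. ricci G brG nablaG x y = - 1 * ipG x y"
    by (simp add: ricci_G)
  define E where "E = (SOME E. orthonormal_basis_of G ipG E)"
  have E: "orthonormal_basis_of G ipG E"
  proof -
    have "\<exists>E. orthonormal_basis_of G ipG E"
      using G_finite_dim orthonormal_basis_exists[OF _ _ inner_product_G] by blast
    then show ?thesis unfolding E_def by (rule someI_ex)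
  qed
  then have b: "basis_of G E" by (simp add: orthonormal_basis_of_def)
  then have fin: "finite E" using G_finite_dim finite_basis_of(2) by blast
  have sub: "E \<subseteq> G" using b by (metis basis_of_def span_superset)
  have "E \<noteq> {}"
  proof
    assume "E = {}"
    then have "eH = 0" using b e_in_G(1) by (auto simp: basis_of_def)
    then show False using e_coord(1) by simp
  qed
  have "scalar_curvature G brG ipG nablaG = (\<Sum>e\<in>E. ricci G brG nablaG e e)"
    by (simp add: scalar_curvature_def E_def)
  also have "\<dots> = (\<Sum>e\<in>E. - 1)"
  proof (intro sum.cong refl)
    fix e assume e: "e \<in> E"
    then have "ipG e e = 1" using E by (simp add: orthonormal_basis_of_def)
    then show "ricci G brG nablaG e e = - 1" using e sub ricci_G[of e e] by auto
  qed
  also have "\<dots> < 0" using fin \<open>E \<noteq> {}\<close> by (simp add: card_gt_0_iff)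
  finally show "scalar_curvature G brG ipG nablaG < 0" .
qed

end

section \<open>The two soliton equations and the normal form of a bivector\<close>

text \<open>
  With \<open>n\<close> indices in \<open>S\<close>, \<open>k\<close> off \<open>S\<close>, and \<open>x\<close>, \<open>z\<close> the squared bracket weights on the two diagonal blocks, the soliton
  equations on \<open>v\<close> are these two linear equations; the mixed block has the weight \<open>(x + z) / 2\<close> since \<open>D\<close> is a
  derivation. Cramer's rule gives the solution. For \<open>n = 2\<close> and \<open>k = 1\<close> it has \<open>z = 0\<close>, which is harmless
  because a single index off \<open>S\<close> has no bracket with itself.
\<close>

lemma soliton_parameters:
  fixes n k :: nat
  assumes n: "n \<ge> 2" and nk: "n + k \<ge> 3"
  obtains x z :: real where "x > 0" "z \<ge> 0" "k \<ge> 2 \<Longrightarrow> z > 0"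
    "x * (n - 1/2 - 2 / n) + k * (x + z) / 2 = 1"
    "k > 0 \<Longrightarrow> (k - 1/2) * z + n * (x + z) / 2 = 1"
proof -
  have n2: "real n \<ge> 2" using n by simp
  then have c: "2 / real n \<le> 1" by simp
  show thesis
  proof (cases "k = 0")
    case True
    then have "real n \<ge> 3" using nk by simp
    then have "real n - 1/2 - 2 / n > 0" using c by linarith
    \<comment> \<open>Without indices off S only the first equation is present, and z is arbitrary.\<close>
    then show thesis using True by (intro that[of "1 / (real n - 1/2 - 2 / n)" 1]) auto
  next
    case False
    then have k: "real k \<ge> 1" by simp
    define A where "A = real n - 1/2 - 2 / n"
    have A: "A \<ge> real n / 2 - 1 / 2" "A \<ge> real n / 4" unfolding A_def using n2 c by linarith+
    define det where "det = (A + k / 2) * (k - 1/2 + real n / 2) - real n * k / 4"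
    have "(real n / 4 + k / 2) * (real k / 2 + real n / 2) \<le> (A + k / 2) * (k - 1/2 + real n / 2)"
      using A k n2 by (intro mult_mono) auto
    moreover have "(real n / 4 + k / 2) * (real k / 2 + real n / 2) > real n * k / 4"
    proof -
      have "(real n / 4 + k / 2) * (real k / 2 + real n / 2) - real n * k / 4
        = real n * k / 8 + real n * n / 8 + real k * k / 4" by (simp add: field_simps)
      also have "\<dots> > 0" using n2 k by (intro add_nonneg_pos add_nonneg_nonneg) auto
      finally show ?thesis by simp
    qed
    ultimately have det: "det > 0" by (simp add: det_def)
    define x where "x = (real k / 2 + real n / 2 - 1 / 2) / det"
    define z where "z = (A + real k / 2 - real n / 2) / det"
    show thesis
    proof (rule that[of x z])
      show "x > 0" using det k n2 by (simp add: x_def)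
      show "z \<ge> 0" using det k A by (simp add: z_def)
      show "z > 0" if "k \<ge> 2" using det that A by (simp add: z_def)
      have xz: "x * det = real k / 2 + real n / 2 - 1 / 2" "z * det = A + real k / 2 - real n / 2"
        using det by (simp_all add: x_def z_def)
      have "(x * A + k * (x + z) / 2) * det = (x * det) * (A + real k / 2) + (z * det) * (real k / 2)"
        by (simp add: algebra_simps add_divide_distrib)
      also have "\<dots> = det" unfolding xz unfolding det_def by (simp add: algebra_simps add_divide_distrib diff_divide_distrib)
      finally show "x * (n - 1/2 - 2 / n) + k * (x + z) / 2 = 1" using det by (simp add: A_def)
      have "((k - 1/2) * z + n * (x + z) / 2) * det = (z * det) * (k - 1/2 + real n / 2) + (x * det) * (real n / 2)"
        by (simp add: algebra_simps add_divide_distrib)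
      also have "\<dots> = det" unfolding xz unfolding det_def by (simp add: algebra_simps add_divide_distrib diff_divide_distrib)
      finally show "(k - 1/2) * z + n * (x + z) / 2 = 1" using det by simp
    qed
  qed
qed

text \<open>
  The relation \<open>sg i j ^ 2 = 2 (d i + d j - 1)\<close> translates the block weights \<open>x\<close> and \<open>z\<close> into the eigenvalues
  \<open>1/2 + x/4\<close> and \<open>1/2 + z/4\<close>.
\<close>

lemma (in bivector) soliton_exists:
  assumes q: "q \<ge> 3"
  obtains d a where "soliton q J S d a"
proof -
  define n where "n = card S"
  define k where "k = card ({..<q} - S)"
  have nk: "n + k = q"
    using card_Diff_subset[OF finite_S S_sub] card_mono[OF _ S_sub] by (simp add: n_def k_def)
  have n: "n \<ge> 2" using card_S_ge_2 by (simp add: n_def)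
  obtain x z :: real where xz: "x > 0" "z \<ge> 0" "k \<ge> 2 \<Longrightarrow> z > 0"
    "x * (n - 1/2 - 2 / n) + k * (x + z) / 2 = 1"
    "k > 0 \<Longrightarrow> (k - 1/2) * z + n * (x + z) / 2 = 1"
    using soliton_parameters[of n k] n nk q by auto
  define a where "a = 1/2 + x / 4"
  define d where "d i = (if i \<in> S then a else 1/2 + z / 4)" for i
  interpret w: weighted_bivector q J S d a
    by unfold_locales (use xz in \<open>auto simp: d_def a_def\<close>)
  have split: "(\<Sum>j\<in>{..<q}-{i}. 2 * (d i + d j - 1))
     = card (S - {i}) * (2 * (d i + a - 1)) + card ({..<q} - S - {i}) * (2 * (d i + 1/2 + z/4 - 1))" for i
  proof -
    have "{..<q} - {i} = (S - {i}) \<union> ({..<q} - S - {i})" using S_sub by auto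
    then have "(\<Sum>j\<in>{..<q}-{i}. 2 * (d i + d j - 1))
      = (\<Sum>j\<in>S - {i}. 2 * (d i + d j - 1)) + (\<Sum>j\<in>{..<q} - S - {i}. 2 * (d i + d j - 1))"
      using finite_S by (metis (no_types, lifting) Diff_disjoint Int_Diff Diff_Int2 finite_Diff finite_lessThan
          inf_commute sum.union_disjoint Diff_eq_empty_iff empty_Diff)
    also have "(\<Sum>j\<in>S - {i}. 2 * (d i + d j - 1)) = (\<Sum>j\<in>S - {i}. 2 * (d i + a - 1))"
      by (intro sum.cong) (auto simp: d_def)
    also have "(\<Sum>j\<in>{..<q} - S - {i}. 2 * (d i + d j - 1)) = (\<Sum>j\<in>{..<q} - S - {i}. 2 * (d i + 1/2 + z/4 - 1))"
      by (intro sum.cong) (auto simp: d_def)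
    finally show ?thesis by simp
  qed
  have "soliton q J S d a"
  proof unfold_locales
    show "d i + d j > 1" if ij: "i < q" "j < q" "i \<noteq> j" for i j
    proof (cases "i \<in> S \<or> j \<in> S")
      case False
      then have "{i, j} \<subseteq> {..<q} - S" using ij by auto
      then have "k \<ge> 2" unfolding k_def using card_mono[of "{..<q} - S" "{i, j}"] ij by simp
      then show ?thesis using xz False by (simp add: d_def)
    qed (use xz in \<open>auto simp: d_def a_def\<close>)
    show "d i + w.casimir i / 2 = 1" if i: "i < q" for i
    proof (cases "i \<in> S")
      case True
      have "card (S - {i}) = n - 1" "{..<q} - S - {i} = {..<q} - S"
        using True finite_S by (auto simp: n_def)
      then have "w.casimir i = (real n - 1) * x + k * (x + z) / 2 - 2 * x / n"
        using True n unfolding w.casimir_def split by (simp add: d_def a_def k_def n_def of_nat_diff field_simps)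
      also have "\<dots> = 1 - x / 2" using xz(4) by (simp add: algebra_simps)
      finally show ?thesis using True by (simp add: d_def a_def field_simps)
    next
      case False
      then have "k > 0" using i by (auto simp: k_def card_gt_0_iff)
      have "card ({..<q} - S - {i}) = k - 1" "S - {i} = S"
        using False i by (auto simp: k_def)
      then have "w.casimir i = n * (x + z) / 2 + (real k - 1) * z"
        using False \<open>k > 0\<close> unfolding w.casimir_def split
        by (simp add: d_def a_def n_def of_nat_diff Suc_leI field_simps)
      also have "\<dots> = 1 - z / 2" using xz(5) \<open>k > 0\<close> by (simp add: algebra_simps)
      finally show ?thesis using False by (simp add: d_def field_simps)
    qed
  qed
  then show thesis by (rule that)
qed

lemma bilinear_alternating_swap:
  assumes V: "subspace V" and br: "bilinear_map_on V br" and alt: "\<And>x. x \<in> V \<Longrightarrow> br x x = 0"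
    and xy: "x \<in> V" "y \<in> V"
  shows "br x y = - br y x"
proof -
  have "x + y \<in> V" using V xy by (rule subspace_add)
  then have "br (x + y) (x + y) = br (x + y) x + br (x + y) y"
    using br xy unfolding bilinear_map_on_def linear_map_on_def by blast
  also have "br (x + y) x = br x x + br y x"
    using br xy unfolding bilinear_map_on_def linear_map_on_def by blast
  also have "br (x + y) y = br x y + br y y"
    using br xy unfolding bilinear_map_on_def linear_map_on_def by blast
  finally show ?thesis using alt xy \<open>x + y \<in> V\<close> by (simp add: eq_neg_iff_add_eq_0 add.commute)
qed

lemma sum_remove_two:
  fixes f :: "'i \<Rightarrow> 'b::ab_group_add"
  assumes "finite I" "p \<in> I" "r \<in> I" "p \<noteq> r"
  shows "sum f I = f p + f r + sum f (I - {p, r})"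
proof -
  have "sum f I = f p + sum f (I - {p})" using assms by (intro sum.remove)
  also have "sum f (I - {p}) = f r + sum f (I - {p} - {r})" using assms by (intro sum.remove) auto
  also have "I - {p} - {r} = I - {p, r}" by auto
  finally show ?thesis by (simp add: add.assoc)
qed

text \<open>
  The bivector is the formal sum \<open>\<Sum> C i j u i \<and> u j\<close>; it is only observed through the bracket \<open>br\<close>. If \<open>C p r = c\<close> is
  nonzero, completing the product gives \<open>\<omega> = 2 ep \<and> er + \<omega>'\<close> with \<open>ep\<close> and \<open>er\<close> as below, where \<open>\<omega>'\<close> no longer
  involves \<open>u p\<close> and \<open>u r\<close>. Induction on the index set then normalises \<open>\<omega>'\<close>.
\<close>

lemma darboux_bivector:
  fixes u :: "nat \<Rightarrow> 'a::real_vector" and br :: "'a \<Rightarrow> 'a \<Rightarrow> 'b::real_vector"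
  assumes V: "subspace V" and br: "bilinear_map_on V br" and alt: "\<And>x. x \<in> V \<Longrightarrow> br x x = 0"
    and "finite I" and C: "\<And>i j. C i j = - C j i" and u: "u ` I \<subseteq> V"
  shows "\<exists>e J S. S \<subseteq> I \<and> (\<forall>i j. J i j = - J j i) \<and> (\<forall>i j. J i j \<noteq> 0 \<longrightarrow> i \<in> S \<and> j \<in> S) \<and>
    (\<forall>i\<in>S. \<forall>k\<in>S. (\<Sum>j\<in>I. J i j * J k j) = kdelta i k) \<and>
    span (e ` I) = span (u ` I) \<and>
    (\<Sum>i\<in>I. \<Sum>j\<in>I. C i j *\<^sub>R br (u i) (u j)) = (\<Sum>i\<in>I. \<Sum>j\<in>I. J i j *\<^sub>R br (e i) (e j)) \<and>
    ((\<exists>i\<in>I. \<exists>j\<in>I. C i j \<noteq> (0::real)) \<longrightarrow> S \<noteq> {})"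
  using \<open>finite I\<close> C u
proof (induction I arbitrary: C rule: finite_psubset_induct)
  case (psubset I C)
  show ?case
  proof (cases "\<exists>p\<in>I. \<exists>r\<in>I. C p r \<noteq> 0")
    case False
    then show ?thesis
      by (intro exI[of _ u] exI[of _ "\<lambda>i j. 0"] exI[of _ "{}"]) auto
  next
    case True
    then obtain p r where pr: "p \<in> I" "r \<in> I" "C p r \<noteq> 0" by blast
    have Cd: "C i i = 0" for i using psubset.prems(1)[of i i] by simp
    have ne: "p \<noteq> r" using pr Cd by auto
    define c where "c = C p r"
    have c: "c \<noteq> 0" using pr by (simp add: c_def)
    define I' where "I' = I - {p, r}"
    have I': "I' \<subset> I" "finite I'" "p \<notin> I'" "r \<notin> I'" using pr psubset.hyps(1) by (auto simp: I'_def)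
    \<comment> \<open>The coefficients of the remaining bivector after the product of ep and er has been split off.\<close>
    define C' where "C' i j = C i j + (C r i * C p j - C r j * C p i) / c" for i j
    have C'skew: "C' i j = - C' j i" for i j
      using psubset.prems(1)[of i j] by (simp add: C'_def algebra_simps diff_divide_distrib)
    have uI0: "u ` I' \<subseteq> V" using psubset.prems(2) by (auto simp: I'_def)
    from psubset.IH[OF I'(1), of C', OF C'skew uI0] obtain e' J' S' where IH0: "S' \<subseteq> I'"
      "\<forall>i j. J' i j = - J' j i" "\<forall>i j. J' i j \<noteq> 0 \<longrightarrow> i \<in> S' \<and> j \<in> S'"
      "\<forall>i\<in>S'. \<forall>k\<in>S'. (\<Sum>j\<in>I'. J' i j * J' k j) = kdelta i k"
      and IH5: "span (e' ` I') = span (u ` I')"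
      and IH6: "(\<Sum>i\<in>I'. \<Sum>j\<in>I'. C' i j *\<^sub>R br (u i) (u j)) = (\<Sum>i\<in>I'. \<Sum>j\<in>I'. J' i j *\<^sub>R br (e' i) (e' j))"
      by (elim exE conjE) (rule that; assumption)
    have IH: "S' \<subseteq> I'" "\<And>i j. J' i j = - J' j i" "\<And>i j. J' i j \<noteq> 0 \<Longrightarrow> i \<in> S' \<and> j \<in> S'"
      "\<And>i k. i \<in> S' \<Longrightarrow> k \<in> S' \<Longrightarrow> (\<Sum>j\<in>I'. J' i j * J' k j) = kdelta i k"
      using IH0 by blast+
    define sp where "sp = (\<Sum>j\<in>I'. (C r j / c) *\<^sub>R u j)"
    define sr where "sr = (\<Sum>j\<in>I'. C p j *\<^sub>R u j)"
    define ep where "ep = u p - sp"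
    define er where "er = c *\<^sub>R u r + sr"
    define e where "e = e'(p := ep, r := er)"
    define J where "J i j = (if i = p \<and> j = r then 1 else if i = r \<and> j = p then -1 else J' i j)" for i j
    define S where "S = insert p (insert r S')"
    have uV: "u i \<in> V" if "i \<in> I" for i using that psubset.prems(2) by auto
    have uI': "u i \<in> V" if "i \<in> I'" for i using that uV by (simp add: I'_def)
    have spV: "sp \<in> V" "sr \<in> V" unfolding sp_def sr_def
      using uI' V by (auto intro!: subspace_sum subspace_scale)
    have swap: "br x y = - br y x" if "x \<in> V" "y \<in> V" for x y
      using bilinear_alternating_swap[OF V br alt] that by blast
    have J'0: "J' i p = 0" "J' i r = 0" "J' p i = 0" "J' r i = 0" for i
      using IH(1) IH(3)[of i p] IH(3)[of i r] IH(3)[of p i] IH(3)[of r i] I' by auto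
    have Jpr: "J p r = 1" "J r p = -1" using ne by (auto simp: J_def)
    have J0: "J p i = 0" "J i p = 0" if "i \<noteq> r" for i using that J'0 ne by (auto simp: J_def)
    have J0': "J r i = 0" "J i r = 0" if "i \<noteq> p" for i using that J'0 ne by (auto simp: J_def)
    have JI': "J i j = J' i j" if "i \<in> I'" for i j using that I'(3,4) unfolding J_def by metis
    have Jskew: "J i j = - J j i" for i j using IH(2)[of i j] ne by (auto simp: J_def)
    have Jz: "J p i = 0" "J r i = 0" if "i \<in> I'" for i
      using that I'(3,4) J0(1)[of i] J0'(1)[of i] by metis+
    have span: "span (e ` I) = span (u ` I)"
    proof -
      have eI': "e i = e' i" if "i \<in> I'" for i using that I' by (auto simp: e_def)
      have im: "u ` I = insert (u p) (insert (u r) (u ` I'))" "e ` I = insert ep (insert er (e' ` I'))"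
        using pr ne by (auto simp: I'_def e_def)
      have u': "span (u ` I') \<subseteq> span (u ` I)" unfolding im by (rule span_mono) blast
      have e': "span (u ` I') \<subseteq> span (e ` I)" unfolding im IH5[symmetric] by (rule span_mono) blast
      have sps: "sp \<in> span (u ` I')" "sr \<in> span (u ` I')"
        unfolding sp_def sr_def by (auto intro!: span_sum span_scale intro: span_base)
      have "ep \<in> span (u ` I)" "er \<in> span (u ` I)"
        unfolding ep_def er_def using u' sps pr
        by (auto intro!: span_diff span_add span_scale intro: span_base)
      moreover have "e' ` I' \<subseteq> span (u ` I)" using u' span_superset[of "e' ` I'"] unfolding IH5 by (rule order_trans[rotated])
      moreover have b: "ep \<in> span (e ` I)" "er \<in> span (e ` I)" unfolding im by (auto intro: span_base)
      then have "ep + sp \<in> span (e ` I)" "(1 / c) *\<^sub>R (er - sr) \<in> span (e ` I)"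
        using sps e' by (auto intro!: span_add span_diff span_scale)
      then have "u p \<in> span (e ` I)" "u r \<in> span (e ` I)" using c by (simp_all add: ep_def er_def)
      moreover have "u ` I' \<subseteq> span (e ` I)" using e' span_superset[of "u ` I'"] by (rule order_trans[rotated])
      ultimately show ?thesis by (subst span_eq) (metis im insert_subset)
    qed
    have rel: "(\<Sum>i\<in>I. \<Sum>j\<in>I. C i j *\<^sub>R br (u i) (u j)) = (\<Sum>i\<in>I. \<Sum>j\<in>I. J i j *\<^sub>R br (e i) (e j))"
    proof -
      have two: "(\<Sum>i\<in>I. \<Sum>j\<in>I. X i j *\<^sub>R br (w i) (w j)) = 2 *\<^sub>R (X p r *\<^sub>R br (w p) (w r)
          + (\<Sum>j\<in>I'. X p j *\<^sub>R br (w p) (w j)) + (\<Sum>j\<in>I'. X r j *\<^sub>R br (w r) (w j)))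
          + (\<Sum>i\<in>I'. \<Sum>j\<in>I'. X i j *\<^sub>R br (w i) (w j))"
        if X: "\<And>i j. X i j = - X j i" and w: "\<And>i. i \<in> I \<Longrightarrow> w i \<in> V" for X :: "nat \<Rightarrow> nat \<Rightarrow> real" and w
      proof -
        have X0: "X i i = 0" for i using X[of i i] by simp
        have s: "X i j *\<^sub>R br (w i) (w j) = X j i *\<^sub>R br (w j) (w i)" if "i \<in> I" "j \<in> I" for i j
          using X[of i j] swap[OF w w, of i j] that by simp
        have "(\<Sum>i\<in>I'. X i p *\<^sub>R br (w i) (w p)) = (\<Sum>j\<in>I'. X p j *\<^sub>R br (w p) (w j))"
          "(\<Sum>i\<in>I'. X i r *\<^sub>R br (w i) (w r)) = (\<Sum>j\<in>I'. X r j *\<^sub>R br (w r) (w j))"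
          using s pr by (auto intro!: sum.cong simp: I'_def)
        then show ?thesis
          using s[OF pr(1,2)]
          by (simp add: sum_remove_two[OF psubset.hyps(1) pr(1,2) ne] I'_def[symmetric] sum.distrib X0 scaleR_2)
      qed
      have ed: "e p = ep" "e r = er" using ne by (auto simp: e_def)
      have eV: "e i \<in> V" if "i \<in> I" for i
      proof -
        have "e i \<in> span (u ` I)" unfolding span[symmetric] using that by (intro span_base) simp
        moreover have "span (u ` I) \<subseteq> V" using psubset.prems(2) V by (rule span_minimal)
        ultimately show ?thesis by blast
      qed
      have E: "br ep er = c *\<^sub>R br (u p) (u r) + (\<Sum>j\<in>I'. C p j *\<^sub>R br (u p) (u j)) + (\<Sum>j\<in>I'. C r j *\<^sub>R br (u r) (u j))
         - (\<Sum>i\<in>I'. \<Sum>j\<in>I'. (C r i * C p j / c) *\<^sub>R br (u i) (u j))"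
      proof -
        have l: "linear_map_on V (br x)" "linear_map_on V (\<lambda>x. br x y)" if "x \<in> V" "y \<in> V" for x y
          using br that by (auto simp: bilinear_map_on_def)
        have V4: "u p \<in> V" "u r \<in> V" "c *\<^sub>R u r \<in> V" "er \<in> V" "ep \<in> V" using uV pr V spV
          by (auto simp: er_def ep_def subspace_scale subspace_add subspace_diff)
        have "br (ep + sp) er = br ep er + br sp er"
          using l(2)[OF V4(4,4)] V4 spV unfolding linear_map_on_def by blast
        then have "br ep er = br (u p) er - br sp er" by (simp add: ep_def)
        also have "br (u p) er = br (u p) (c *\<^sub>R u r) + br (u p) sr"
          using l(1)[OF V4(1,1)] V4 spV unfolding linear_map_on_def er_def by blast
        also have "br (u p) (c *\<^sub>R u r) = c *\<^sub>R br (u p) (u r)"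
          using l(1)[OF V4(1,1)] V4 unfolding linear_map_on_def by blast
        also have "br (u p) sr = (\<Sum>j\<in>I'. C p j *\<^sub>R br (u p) (u j))"
          unfolding sr_def by (rule linear_map_on_sum[OF V l(1)[OF V4(1,1)] uI'])
        also have "br sp er = br sp (c *\<^sub>R u r) + br sp sr"
          using l(1)[OF spV(1,1)] V4 spV unfolding linear_map_on_def er_def by blast
        also have "br sp (c *\<^sub>R u r) = c *\<^sub>R br sp (u r)"
          using l(1)[OF spV(1,1)] V4 unfolding linear_map_on_def by blast
        also have "br sp (u r) = (\<Sum>j\<in>I'. (C r j / c) *\<^sub>R br (u j) (u r))"
          unfolding sp_def by (rule linear_map_on_sum[OF V l(2)[OF V4(2,2)] uI'])
        also have "c *\<^sub>R \<dots> = (\<Sum>j\<in>I'. C r j *\<^sub>R br (u j) (u r))"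
          using c by (simp add: scaleR_sum_right)
        also have "\<dots> = - (\<Sum>j\<in>I'. C r j *\<^sub>R br (u r) (u j))"
          unfolding sum_negf[symmetric] using swap[OF uI' V4(2)] by (intro sum.cong refl) simp
        also have "br sp sr = (\<Sum>i\<in>I'. \<Sum>j\<in>I'. (C r i / c * C p j) *\<^sub>R br (u i) (u j))"
          unfolding sp_def sr_def by (rule bilinear_map_on_sum[OF V br uI' uI'])
        finally show ?thesis by simp
      qed
      have "(\<Sum>i\<in>I'. \<Sum>j\<in>I'. C' i j *\<^sub>R br (u i) (u j))
        = (\<Sum>i\<in>I'. \<Sum>j\<in>I'. C i j *\<^sub>R br (u i) (u j)) + 2 *\<^sub>R (\<Sum>i\<in>I'. \<Sum>j\<in>I'. (C r i * C p j / c) *\<^sub>R br (u i) (u j))"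
      proof -
        have "(\<Sum>i\<in>I'. \<Sum>j\<in>I'. (C r j * C p i / c) *\<^sub>R br (u i) (u j))
          = (\<Sum>j\<in>I'. \<Sum>i\<in>I'. - ((C r j * C p i / c) *\<^sub>R br (u j) (u i)))"
          unfolding scaleR_minus_right[symmetric]
          by (subst sum.swap, rule sum.cong[OF refl], rule sum.cong[OF refl]) (metis swap uI')
        then show ?thesis
          by (simp add: C'_def scaleR_add_left diff_divide_distrib scaleR_diff_left sum.distrib sum_subtractf
              sum_negf scaleR_2)
      qed
      moreover have "(\<Sum>i\<in>I'. \<Sum>j\<in>I'. J i j *\<^sub>R br (e i) (e j)) = (\<Sum>i\<in>I'. \<Sum>j\<in>I'. J' i j *\<^sub>R br (e' i) (e' j))"
        using I' JI' by (intro sum.cong refl) (auto simp: e_def)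
      moreover have "(\<Sum>j\<in>I'. J p j *\<^sub>R br ep (e j)) = 0" "(\<Sum>j\<in>I'. J r j *\<^sub>R br er (e j)) = 0"
        using Jz by simp_all
      ultimately show ?thesis
        using two[of C u, OF psubset.prems(1) uV] two[of J e, OF Jskew eV] IH6
        by (simp add: ed Jpr c_def[symmetric] E algebra_simps)
    qed
    have rows: "(\<Sum>j\<in>I. J i j * J k j) = kdelta i k" if ik: "i \<in> S" "k \<in> S" for i k
    proof -
      have s: "(\<Sum>j\<in>I. J i j * J k j) = J i p * J k p + J i r * J k r + (\<Sum>j\<in>I'. J i j * J k j)"
        by (simp add: sum_remove_two[OF psubset.hyps(1) pr(1,2) ne] I'_def)
      have z: "(\<Sum>j\<in>I'. J p j * y j) = 0" "(\<Sum>j\<in>I'. J r j * y j) = 0"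
        "(\<Sum>j\<in>I'. y j * J p j) = 0" "(\<Sum>j\<in>I'. y j * J r j) = 0" for y :: "nat \<Rightarrow> real"
        using Jz by simp_all
      have d: "J p p = 0" "J r r = 0" using J0 J0' ne by auto
      consider "i = p" | "i = r" | "i \<in> S'" "i \<in> I'" "i \<noteq> p" "i \<noteq> r"
        using ik IH(1) I'(3,4) unfolding S_def by blast
      note ci = this
      consider "k = p" | "k = r" | "k \<in> S'" "k \<in> I'" "k \<noteq> p" "k \<noteq> r"
        using ik IH(1) I'(3,4) unfolding S_def by blast
      then show ?thesis
        unfolding s by (cases rule: ci; cases)
          (use ne in \<open>simp_all add: z d Jpr J0 J0' J'0 JI' IH(4) ne[symmetric]\<close>)
    qed
    show ?thesis
    proof (intro exI[of _ e] exI[of _ J] exI[of _ S] conjI allI ballI impI)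
      show "S \<subseteq> I" using IH(1) I' pr by (auto simp: S_def)
      show "J i j = - J j i" for i j by (rule Jskew)
      show "i \<in> S" "j \<in> S" if "J i j \<noteq> 0" for i j
        using that IH(3)[of i j] by (auto simp: J_def S_def split: if_splits)
      show "S \<noteq> {}" by (simp add: S_def)
    qed (use span rel rows in auto)
  qed
qed

section \<open>Identification of the nilpotent algebra with the model\<close>

text \<open>
  For families instead of sets: a repeated vector also counts as a relation.
\<close>

lemma nontrivial_relation:
  fixes f :: "'s \<Rightarrow> 'a::real_vector"
  assumes "finite T" "dim (f ` T) < card T"
  shows "\<exists>c. (\<Sum>t\<in>T. c t *\<^sub>R f t) = 0 \<and> (\<exists>t\<in>T. c t \<noteq> 0)"
proof (cases "inj_on f T")
  case True
  then have "card (f ` T) = card T" by (rule card_image)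
  then have "dependent (f ` T)"
    using assms dim_eq_card_independent[of "f ` T"] by fastforce
  then obtain c v where c: "(\<Sum>v\<in>f ` T. c v *\<^sub>R v) = 0" "v \<in> f ` T" "c v \<noteq> 0"
    using assms(1) dependent_finite[of "f ` T"] by auto
  then show ?thesis using True
    by (intro exI[of _ "c \<circ> f"]) (auto simp: sum.reindex)
next
  case False
  then obtain s t where st: "s \<in> T" "t \<in> T" "s \<noteq> t" "f s = f t" by (auto simp: inj_on_def)
  define c where "c r = (if r = s then 1 else if r = t then -1 else (0::real))" for r
  have "(\<Sum>r\<in>T. c r *\<^sub>R f r) = c s *\<^sub>R f s + c t *\<^sub>R f t + (\<Sum>r\<in>T - {s, t}. c r *\<^sub>R f r)"
    using st assms(1) by (intro sum_remove_two)
  also have "\<dots> = 0" using st by (simp add: c_def)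
  finally show ?thesis using st by (intro exI[of _ c]) (auto simp: c_def)
qed

lemma spanning_family_independent:
  fixes g :: "'s \<Rightarrow> 'a::real_vector"
  assumes T: "finite T" and V: "V \<subseteq> span (g ` T)" "card T \<le> dim V"
    and c: "(\<Sum>t\<in>T. c t *\<^sub>R g t) = 0" "s \<in> T"
  shows "c s = 0"
proof (rule ccontr)
  assume cs: "c s \<noteq> 0"
  let ?S = "span (g ` (T - {s}))"
  have "c s *\<^sub>R g s + (\<Sum>t\<in>T - {s}. c t *\<^sub>R g t) = 0"
    using c T by (simp add: sum.remove)
  then have "c s *\<^sub>R g s = - (\<Sum>t\<in>T - {s}. c t *\<^sub>R g t)" by (simp add: eq_neg_iff_add_eq_0)
  also have "\<dots> \<in> ?S" by (intro span_neg span_sum span_scale span_base) auto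
  finally have "(1 / c s) *\<^sub>R (c s *\<^sub>R g s) \<in> ?S" by (rule span_scale)
  then have "g s \<in> ?S" using cs by simp
  moreover have "g t \<in> ?S" if "t \<in> T" "t \<noteq> s" for t using that by (auto intro: span_base)
  ultimately have "g ` T \<subseteq> ?S" by blast
  then have "V \<subseteq> ?S" using V(1) span_minimal[OF _ subspace_span] by blast
  then have "dim V \<le> card (g ` (T - {s}))" using T by (intro dim_le_card) auto
  also have "\<dots> \<le> card (T - {s})" using T by (intro card_image_le) auto
  also have "\<dots> < card T" using T c(2) by (intro card_Diff1_less)
  finally show False using V(2) by simp
qed

lemma sum_symmetric_square:
  fixes h :: "nat \<Rightarrow> nat \<Rightarrow> 'b::real_vector"
  assumes "\<And>i j. h i j = h j i" "\<And>i. h i i = 0"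
  shows "(\<Sum>i<q. \<Sum>j<q. h i j) = 2 *\<^sub>R (\<Sum>(i, j)\<in>Sigma {..<q} (\<lambda>i. {..<i}). h i j)"
proof -
  have "(\<Sum>i<q. \<Sum>j<q. h i j) = 2 *\<^sub>R (\<Sum>i<q. \<Sum>j<i. h i j)"
  proof (induction q)
    case (Suc q)
    have "(\<Sum>i<q. h i q) = (\<Sum>j<q. h q j)" using assms(1) by (intro sum.cong refl)
    then show ?case using Suc assms(2) by (simp add: sum.distrib scaleR_add_right scaleR_2)
  qed simp
  then show ?thesis by (simp add: sum.Sigma)
qed

lemma card_triangle: "card (Sigma {..<q} (\<lambda>i. {..<i})) = q * (q - 1) div 2" for q :: nat
proof -
  have "2 * (\<Sum>i<q. i) = q * (q - 1)" by (induction q) (auto simp: algebra_simps diff_mult_distrib2 split: nat_diff_split)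
  then show ?thesis by simp
qed

lemma lie_isomorphic_sym:
  assumes W: "subspace W" and cl: "\<And>x y. x \<in> W \<Longrightarrow> y \<in> W \<Longrightarrow> br' x y \<in> W"
    and iso: "lie_isomorphic W br' V br"
  shows "lie_isomorphic V br W br'"
proof -
  obtain f where f: "bij_betw f W V" "linear_map_on W f" "\<And>x y. x \<in> W \<Longrightarrow> y \<in> W \<Longrightarrow> f (br' x y) = br (f x) (f y)"
    using iso by (auto simp: lie_isomorphic_def)
  let ?g = "inv_into W f"
  have g: "?g x \<in> W" "f (?g x) = x" if "x \<in> V" for x
    using f(1) that by (auto simp: bij_betw_def inv_into_into f_inv_into_f)
  have gf: "?g (f x) = x" if "x \<in> W" for x
    using f(1) that by (simp add: bij_betw_def)
  have "linear_map_on V ?g"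
    unfolding linear_map_on_def
  proof (intro conjI ballI allI)
    fix x y assume xy: "x \<in> V" "y \<in> V"
    have "f (?g x + ?g y) = x + y" using f(2) g xy by (simp add: linear_map_on_def)
    then show "?g (x + y) = ?g x + ?g y" using gf[of "?g x + ?g y"] g xy W by (simp add: subspace_add)
  next
    fix c x assume x: "x \<in> V"
    have "f (c *\<^sub>R ?g x) = c *\<^sub>R x" using f(2) g x by (simp add: linear_map_on_def)
    then show "?g (c *\<^sub>R x) = c *\<^sub>R ?g x" using gf[of "c *\<^sub>R ?g x"] g x W by (simp add: subspace_scale)
  qed
  moreover have "?g (br x y) = br' (?g x) (?g y)" if "x \<in> V" "y \<in> V" for x y
    using f(3)[of "?g x" "?g y"] g that gf[of "br' (?g x) (?g y)"] cl by simp
  ultimately show ?thesis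
    unfolding lie_isomorphic_def using bij_betw_inv_into[OF f(1)] by blast
qed

context soliton
begin

text \<open>
  The isomorphism is constructed from the model to \<open>V\<close>, where it is given by a formula: \<open>v\<close> goes to \<open>\<Sum> v i e i\<close> and
  a matrix \<open>A\<close> to half the sum of \<open>A i j / sg i j\<close> times \<open>[e i, e j]\<close>. It is a homomorphism because the
  correction term of the projection is a multiple of the relation \<open>J\<close>. Injectivity rests on a dimension
  count: after one bracket \<open>[e p, e r]\<close> with \<open>J p r \<noteq> 0\<close> has been expressed through the others, the vectors \<open>e i\<close>
  and the remaining brackets span \<open>V\<close> and are as many as \<open>dim V\<close>, hence independent.
\<close>

lemma lie_isomorphic_N:
  fixes V :: "'a::real_vector set" and e :: "nat \<Rightarrow> 'a"
  assumes V: "subspace V" and br: "bilinear_map_on V br" and alt: "\<And>x. x \<in> V \<Longrightarrow> br x x = 0"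
    and brV: "\<And>x y. x \<in> V \<Longrightarrow> y \<in> V \<Longrightarrow> br x y \<in> V"
    and W: "subspace W" "W \<subseteq> V" "\<And>x y. x \<in> V \<Longrightarrow> y \<in> V \<Longrightarrow> br x y \<in> W"
    and central: "\<And>x w. x \<in> V \<Longrightarrow> w \<in> W \<Longrightarrow> br x w = 0"
    and eV: "\<And>i. i < q \<Longrightarrow> e i \<in> V"
    and gen: "V \<subseteq> span (e ` {..<q} \<union> (\<lambda>(i, j). br (e i) (e j)) ` ({..<q} \<times> {..<q}))"
    and dimV: "dim V = q + (q * (q - 1) div 2 - 1)"
    and rel: "(\<Sum>i<q. \<Sum>j<q. J i j *\<^sub>R br (e i) (e j)) = 0"
  shows "lie_isomorphic V br N brG"
proof -
  let ?b = "\<lambda>i j. br (e i) (e j)"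
  define E where "E x = (\<Sum>i<q. vc x i *\<^sub>R e i)" for x
  define B where "B x = (\<Sum>i<q. \<Sum>j<q. (ac x i j / sg i j) *\<^sub>R ?b i j)" for x
  define F where "F x = E x + (1/2) *\<^sub>R B x" for x
  have swap: "br x y = - br y x" if "x \<in> V" "y \<in> V" for x y
    using bilinear_alternating_swap[OF V br alt] that by blast
  have bswap: "?b i j = - ?b j i" if "i < q" "j < q" for i j using swap eV that by blast
  have bdiag: "?b i i = 0" if "i < q" for i using alt eV that by blast
  have EV: "E x \<in> V" for x unfolding E_def using V eV by (intro subspace_sum subspace_scale) auto
  have BW: "B x \<in> W" for x unfolding B_def using W eV by (intro subspace_sum subspace_scale) auto
  have FV: "F x \<in> V" for x unfolding F_def using EV BW W V by (intro subspace_add subspace_scale) auto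
  have lin: "F (x + y) = F x + F y" "F (c *\<^sub>R x) = c *\<^sub>R F x" for x y c
    by (simp_all add: F_def E_def B_def coord_add coord_scale scaleR_add_left add_divide_distrib
        sum.distrib scaleR_add_right scaleR_sum_right algebra_simps)
  have brF: "br (F x) (F y) = (\<Sum>i<q. \<Sum>j<q. (vc x i * vc y j) *\<^sub>R ?b i j)" for x y
  proof -
    let ?w = "(1/2) *\<^sub>R B x" and ?w' = "(1/2) *\<^sub>R B y"
    have w: "?w \<in> W" "?w' \<in> W" using BW W by (auto intro: subspace_scale)
    then have wV: "?w \<in> V" "?w' \<in> V" using W by auto
    have "br (F x) (F y) = br (F x) (E y) + br (F x) ?w'"
      unfolding F_def[of y] using br FV[of x] EV[of y] wV unfolding bilinear_map_on_def linear_map_on_def by blast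
    also have "br (F x) ?w' = 0" using central FV w by blast
    also have "br (F x) (E y) = br (E x) (E y) + br ?w (E y)"
      unfolding F_def[of x] using br EV[of y] EV[of x] wV unfolding bilinear_map_on_def linear_map_on_def by blast
    also have "br ?w (E y) = 0" using central[OF EV w(1), of y] swap[OF wV(1) EV] by simp
    also have "br (E x) (E y) = (\<Sum>i<q. \<Sum>j<q. (vc x i * vc y j) *\<^sub>R ?b i j)"
      unfolding E_def using eV by (intro bilinear_map_on_sum[OF V br]) auto
    finally show ?thesis by simp
  qed
  have hom: "F (brG x y) = br (F x) (F y)" if "x \<in> N" "y \<in> N" for x y
  proof -
    define k where "k = jprod (\<lambda>i j. sg i j * (vc x i * vc y j - vc x j * vc y i)) / card S / al"
    have "E (brG x y) = 0" unfolding E_def using that by (intro sum.neutral) (auto simp: brG_coord N_def)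
    moreover have "B (brG x y) = (\<Sum>i<q. \<Sum>j<q. (vc x i * vc y j) *\<^sub>R ?b i j)
       - (\<Sum>i<q. \<Sum>j<q. (vc x j * vc y i) *\<^sub>R ?b i j) - k *\<^sub>R (\<Sum>i<q. \<Sum>j<q. J i j *\<^sub>R ?b i j)"
      unfolding B_def scaleR_sum_right sum_subtractf[symmetric]
    proof (intro sum.cong refl)
      fix i j assume ij: "i \<in> {..<q}" "j \<in> {..<q}"
      show "(ac (brG x y) i j / sg i j) *\<^sub>R ?b i j
        = (vc x i * vc y j) *\<^sub>R ?b i j - (vc x j * vc y i) *\<^sub>R ?b i j - k *\<^sub>R J i j *\<^sub>R ?b i j"
      proof (cases "i = j")
        case True
        then show ?thesis using ij bdiag by simp
      next
        case False
        then have sg: "sg i j \<noteq> 0" using d_gt[of i j] ij by (simp add: sg_def)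
        have "J i j / sg i j = J i j / al"
          using J_supp[of i j] by (cases "J i j = 0") (auto simp: sg_def al_def d_on)
        then have "ac (brG x y) i j / sg i j = vc x i * vc y j - vc x j * vc y i - k * J i j"
          using ij that sg
          by (simp add: brG_coord N_def wedge_def proj_def k_def diff_divide_distrib)
            (metis times_divide_eq_right)
        then show ?thesis by (simp add: scaleR_diff_left)
      qed
    qed
    moreover have "(\<Sum>i<q. \<Sum>j<q. (vc x j * vc y i) *\<^sub>R ?b i j) = - (\<Sum>i<q. \<Sum>j<q. (vc x i * vc y j) *\<^sub>R ?b i j)"
    proof -
      have "(\<Sum>i<q. \<Sum>j<q. (vc x j * vc y i) *\<^sub>R ?b i j) = (\<Sum>j<q. \<Sum>i<q. (vc x j * vc y i) *\<^sub>R ?b i j)"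
        by (rule sum.swap)
      also have "\<dots> = (\<Sum>j<q. \<Sum>i<q. - ((vc x j * vc y i) *\<^sub>R ?b j i))"
      proof (intro sum.cong refl)
        fix i j assume "i \<in> {..<q}" "j \<in> {..<q}"
        then show "(vc x j * vc y i) *\<^sub>R ?b i j = - ((vc x j * vc y i) *\<^sub>R ?b j i)"
          using bswap[of i j] by simp
      qed
      finally show ?thesis by (simp add: sum_negf)
    qed
    ultimately show ?thesis unfolding brF F_def[of "brG x y"] rel by (simp add: scaleR_add_right flip: scaleR_2)
  qed
  have FeV: "F (eV i) = e i" if "i < q" for i
  proof -
    have "E (eV i) = (\<Sum>j<q. if j = i then e i else 0)"
      unfolding E_def by (intro sum.cong) (auto simp: e_coord kdelta_def)
    then show ?thesis using that by (simp add: F_def B_def e_coord)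
  qed
  have eVN: "eV i \<in> N" for i by (simp add: N_def e_in_G e_coord)
  have surj: "V \<subseteq> F ` N"
  proof -
    have "subspace (F ` N)"
    proof (rule subspaceI)
      show "0 \<in> F ` N" using lin(2)[of 0 0] subspace_0[OF subspace_N] by (metis imageI scaleR_zero_left)
      show "x + y \<in> F ` N" if "x \<in> F ` N" "y \<in> F ` N" for x y
        using that lin(1) subspace_add[OF subspace_N] by (metis (no_types, lifting) image_iff)
      show "c *\<^sub>R x \<in> F ` N" if "x \<in> F ` N" for x c
        using that lin(2) subspace_scale[OF subspace_N] by (metis (no_types, lifting) image_iff)
    qed
    moreover have "e i \<in> F ` N" if "i < q" for i using FeV[OF that] eVN by (metis imageI)
    moreover have "?b i j \<in> F ` N" if "i < q" "j < q" for i j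
    proof -
      have "?b i j = F (brG (eV i) (eV j))" using hom eVN FeV that by simp
      moreover have "brG (eV i) (eV j) \<in> N" by (simp add: brG_in_N e_in_G)
      ultimately show ?thesis by blast
    qed
    ultimately have "span (e ` {..<q} \<union> (\<lambda>(i, j). ?b i j) ` ({..<q} \<times> {..<q})) \<subseteq> F ` N"
      by (intro span_minimal) auto
    then show ?thesis using gen by blast
  qed
  define P where "P = Sigma {..<q} (\<lambda>i. {..<i})"
  have finP: "finite P" by (simp add: P_def)
  have Pq: "i < q" "j < q" "j < i" if "(i, j) \<in> P" for i j using that by (auto simp: P_def)
  obtain p r where pr: "(p, r) \<in> P" "J p r \<noteq> 0"
  proof -
    obtain i where i: "i \<in> S" using S_nonempty by blast
    then have "(\<Sum>j<q. J i j * J i j) \<noteq> 0" by (simp add: J_rows)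
    then obtain j where j: "J i j \<noteq> 0" by (metis (no_types, lifting) mult_zero_left sum.neutral)
    then have "i < q" "j < q" "i \<noteq> j" "J j i \<noteq> 0" using J_supp S_sub J_skew[of i j] by auto
    then show thesis using that[of i j] that[of j i] j by (cases "j < i") (auto simp: P_def)
  qed
  define P0 where "P0 = P - {(p, r)}"
  have sumP: "(\<Sum>i<q. \<Sum>j<q. M i j *\<^sub>R ?b i j) = 2 *\<^sub>R (\<Sum>(i, j)\<in>P. M i j *\<^sub>R ?b i j)"
    if M: "\<And>i j. i < q \<Longrightarrow> j < q \<Longrightarrow> M i j = - M j i" for M
  proof -
    let ?h = "\<lambda>i j. if i < q \<and> j < q then M i j *\<^sub>R ?b i j else 0"
    have "(\<Sum>i<q. \<Sum>j<q. M i j *\<^sub>R ?b i j) = (\<Sum>i<q. \<Sum>j<q. ?h i j)"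
      by (intro sum.cong) auto
    also have "\<dots> = 2 *\<^sub>R (\<Sum>(i, j)\<in>P. ?h i j)"
      unfolding P_def
    proof (rule sum_symmetric_square)
      show "?h i j = ?h j i" for i j using M[of i j] bswap[of i j] by auto
      show "?h i i = 0" for i using bdiag by auto
    qed
    also have "(\<Sum>(i, j)\<in>P. ?h i j) = (\<Sum>(i, j)\<in>P. M i j *\<^sub>R ?b i j)"
      using Pq by (intro sum.cong) auto
    finally show ?thesis .
  qed
  define g where "g t = (case t of Inl i \<Rightarrow> e i | Inr (i, j) \<Rightarrow> ?b i j)" for t
  define T where "T = {..<q} <+> P0"
  have finT: "finite T" using finP by (simp add: T_def P0_def)
  have cardP: "card P0 = q * (q - 1) div 2 - 1"
    using pr(1) finP card_triangle[of q] by (simp add: P0_def P_def)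
  have cardT: "card T \<le> dim V"
    using finP cardP dimV unfolding T_def by (subst card_Plus) (auto simp: P0_def)
  have gT: "V \<subseteq> span (g ` T)"
  proof -
    let ?s = "span (g ` T)"
    have e: "e i \<in> ?s" if "i < q" for i
      using that by (intro span_base) (force simp: g_def T_def image_iff)
    have b0: "?b i j \<in> ?s" if "(i, j) \<in> P0" for i j
      using that by (intro span_base) (force simp: g_def T_def image_iff)
    have "?b p r \<in> ?s"
    proof -
      have "2 *\<^sub>R (\<Sum>(i, j)\<in>P. J i j *\<^sub>R ?b i j) = 0" using rel sumP[of J] J_skew by metis
      then have "J p r *\<^sub>R ?b p r + (\<Sum>(i, j)\<in>P0. J i j *\<^sub>R ?b i j) = 0"
        using pr(1) finP by (simp add: sum.remove P0_def)
      then have "J p r *\<^sub>R ?b p r = - (\<Sum>(i, j)\<in>P0. J i j *\<^sub>R ?b i j)" by (simp add: eq_neg_iff_add_eq_0)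
      moreover have "- (\<Sum>(i, j)\<in>P0. J i j *\<^sub>R ?b i j) \<in> ?s"
        using b0 by (intro span_neg span_sum) (auto intro: span_scale)
      ultimately have "(1 / J p r) *\<^sub>R (J p r *\<^sub>R ?b p r) \<in> ?s" by (metis span_scale)
      then show ?thesis using pr(2) by simp
    qed
    then have bP: "?b i j \<in> ?s" if "(i, j) \<in> P" for i j
      using that b0 by (cases "(i, j) = (p, r)") (auto simp: P0_def)
    have "?b i j \<in> ?s" if "i < q" "j < q" for i j
    proof -
      consider "j < i" | "i = j" | "i < j" by linarith
      then show ?thesis
      proof cases
        case 3
        then have "?b j i \<in> ?s" using that by (intro bP) (simp add: P_def)
        then show ?thesis using bswap[OF that] span_neg by metis
      qed (use that bP bdiag in \<open>auto simp: P_def span_zero\<close>)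
    qed
    then have "e ` {..<q} \<union> (\<lambda>(i, j). ?b i j) ` ({..<q} \<times> {..<q}) \<subseteq> ?s" using e by auto
    then show ?thesis using gen span_minimal[OF _ subspace_span] by blast
  qed
  have inj0: "x = 0" if x: "x \<in> N" "F x = 0" for x
  proof -
    have xG: "x \<in> G" using x by (simp add: N_def)
    have z: "zmat (ac x)" using xG by (rule zmat_ac)
    define M where "M i j = ac x i j / sg i j" for i j
    \<comment> \<open>Subtracting a multiple of J removes the entry (p, r); the kernel of the map would be spanned by J, which is orthogonal to the centre.\<close>
    define t where "t = M p r / J p r"
    define M' where "M' i j = M i j - t * J i j" for i j
    have M: "M i j = - M j i" for i j using zmat_skew[OF z, of i j] by (simp add: M_def sg_sym[of i j])
    have M': "M' i j = - M' j i" for i j using M[of i j] J_skew[of i j] by (simp add: M'_def)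
    have M'pr: "M' p r = 0" using pr by (simp add: M'_def t_def)
    have "B x = (\<Sum>i<q. \<Sum>j<q. M' i j *\<^sub>R ?b i j) + t *\<^sub>R (\<Sum>i<q. \<Sum>j<q. J i j *\<^sub>R ?b i j)"
      by (simp add: B_def M'_def M_def scaleR_diff_left sum_subtractf scaleR_sum_right)
    also have "\<dots> = 2 *\<^sub>R (\<Sum>(i, j)\<in>P. M' i j *\<^sub>R ?b i j)" unfolding rel sumP[of M', OF M'] by simp
    also have "(\<Sum>(i, j)\<in>P. M' i j *\<^sub>R ?b i j) = (\<Sum>(i, j)\<in>P0. M' i j *\<^sub>R ?b i j)"
      using pr(1) finP M'pr by (simp add: sum.remove P0_def)
    finally have Bx: "(1/2) *\<^sub>R B x = (\<Sum>(i, j)\<in>P0. M' i j *\<^sub>R ?b i j)" by simp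
    define c where "c s = (case s of Inl i \<Rightarrow> vc x i | Inr (i, j) \<Rightarrow> M' i j)" for s
    have "(\<Sum>s\<in>T. c s *\<^sub>R g s) = (\<Sum>i<q. vc x i *\<^sub>R e i) + (\<Sum>s\<in>P0. c (Inr s) *\<^sub>R g (Inr s))"
      unfolding T_def using finP by (subst sum.Plus) (auto simp: c_def g_def P0_def)
    also have "(\<Sum>s\<in>P0. c (Inr s) *\<^sub>R g (Inr s)) = (\<Sum>(i, j)\<in>P0. M' i j *\<^sub>R ?b i j)"
      by (intro sum.cong) (auto simp: c_def g_def)
    finally have "(\<Sum>s\<in>T. c s *\<^sub>R g s) = 0" using x(2) Bx by (simp add: F_def E_def)
    then have c0: "c s = 0" if "s \<in> T" for s
      using spanning_family_independent[OF finT gT cardT] that by blast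
    have v0: "vc x i = 0" if "i < q" for i using c0[of "Inl i"] that by (auto simp: c_def T_def Plus_def)
    have MP: "M' i j = 0" if "(i, j) \<in> P" for i j
      using c0[of "Inr (i, j)"] M'pr that by (cases "(i, j) = (p, r)") (auto simp: c_def T_def P0_def)
    have Md: "M' i i = 0" for i using M'[of i i] by simp
    have M0: "M' i j = 0" if "i < q" "j < q" for i j
    proof -
      consider "j < i" | "i = j" | "i < j" by linarith
      then show ?thesis
      proof cases
        case 3
        then have "M' j i = 0" using that by (intro MP) (simp add: P_def)
        then show ?thesis using M'[of i j] by simp
      qed (use that MP Md in \<open>auto simp: P_def\<close>)
    qed
    have a: "ac x i j = t * al * J i j" if ij: "i < q" "j < q" for i j
    proof (cases "i = j")
      case True
      then show ?thesis using zmat_skew[OF z, of i i] by simp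
    next
      case False
      then have "sg i j \<noteq> 0" using d_gt[of i j] ij by (simp add: sg_def)
      then have "ac x i j = sg i j * M i j" by (simp add: M_def)
      also have "M i j = t * J i j" using M0[OF ij] by (simp add: M'_def)
      finally show ?thesis using J_sg(2)[of i j] by simp
    qed
    have "0 = jprod (ac x)" using zmat_jprod[OF z] by simp
    also have "\<dots> = jprod (\<lambda>i j. (t * al) * J i j)" by (rule jprod_cong) (simp add: a)
    also have "\<dots> = t * al * card S" unfolding jprod_scale jprod_J by simp
    finally have "t * al = 0" using card_S_pos by simp
    then show ?thesis
      using v0 a x xG subspace_0[OF subspace_G] by (intro G_eqI) (auto simp: N_def)
  qed
  have "inj_on F N"
  proof (rule inj_onI)
    fix x y assume xy: "x \<in> N" "y \<in> N" "F x = F y"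
    have "F (x - y) = 0" using lin(1)[of "x - y" y] xy by simp
    then have "x - y = 0" using inj0 xy subspace_diff[OF subspace_N] by blast
    then show "x = y" by simp
  qed
  moreover have "F ` N = V" using surj FV by blast
  ultimately have "lie_isomorphic N brG V br"
    unfolding lie_isomorphic_def using lin hom
    by (intro exI[of _ F]) (auto simp: bij_betw_def linear_map_on_def)
  moreover have "brG x y \<in> N" if "x \<in> N" "y \<in> N" for x y using brG_in_N that by (auto simp: N_def)
  ultimately show ?thesis using lie_isomorphic_sym[OF subspace_N] by blast
qed

end

text \<open>
  A complement of the commutator ideal: extend a basis of the ideal to a basis of \<open>V\<close>.
\<close>

lemma two_step_generators:
  fixes V :: "'a::real_vector set"
  assumes "lie_algebra V br" "two_step_of_type V br p q"
  obtains u :: "nat \<Rightarrow> 'a" where "u ` {..<q} \<subseteq> V" "V \<subseteq> span (u ` {..<q} \<union> bracket_span br V V)"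
proof -
  let ?W = "bracket_span br V V"
  obtain A where A: "finite A" "span A = V" using lie_algebra.finite_dimensional[OF assms(1)] by blast
  then have V: "subspace V" by force
  have WV: "?W \<subseteq> V" unfolding bracket_span_def
    using lie_algebra.bracket_closed[OF assms(1)] V by (intro span_minimal) auto
  have dims: "dim V = p + q" "dim ?W = p" using assms(2) by (auto simp: two_step_of_type_def)
  obtain B where B: "B \<subseteq> ?W" "independent B" "?W \<subseteq> span B" "card B = dim ?W"
    using basis_exists[of ?W] by blast
  obtain C where C: "B \<subseteq> C" "C \<subseteq> V" "independent C" "V \<subseteq> span C"
    using maximal_independent_subset_extend[of B V] B WV by blast
  have "C \<subseteq> span A" using C A by simp
  then have finC: "finite C" using independent_span_bound[OF A(1) C(3)] by blast
  have "card C = dim V" using C by (metis basis_card_eq_dim)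
  then have card: "card (C - B) = q"
    using C(1) finC B(4) dims by (simp add: card_Diff_subset finite_subset)
  obtain u where u: "bij_betw u {..<q} (C - B)"
    using ex_bij_betw_nat_finite[of "C - B"] finC card by (auto simp: atLeast0LessThan)
  show thesis
  proof (rule that[of u])
    have im: "u ` {..<q} = C - B" using u by (simp add: bij_betw_def)
    show "u ` {..<q} \<subseteq> V" using im C by auto
    have "C \<subseteq> u ` {..<q} \<union> ?W" using im B by auto
    then show "V \<subseteq> span (u ` {..<q} \<union> ?W)" using C(4) span_mono by blast
  qed
qed

lemma span_image_combination:
  fixes e :: "'i \<Rightarrow> 'a::real_vector"
  assumes I: "finite I" and y: "y \<in> span (e ` I)"
  shows "\<exists>a. y = (\<Sum>i\<in>I. a i *\<^sub>R e i)"
  using y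
proof (induction rule: span_induct_alt)
  case base
  show ?case by (intro exI[of _ "\<lambda>i. 0"]) simp
next
  case (step c x y)
  then obtain j a where j: "j \<in> I" "x = e j" and a: "y = (\<Sum>i\<in>I. a i *\<^sub>R e i)" by blast
  have "(\<Sum>i\<in>I. (if i = j then c else 0) *\<^sub>R e i) = (\<Sum>i\<in>I. if i = j then c *\<^sub>R e j else 0)"
    by (intro sum.cong) auto
  then have "c *\<^sub>R x + y = (\<Sum>i\<in>I. ((if i = j then c else 0) + a i) *\<^sub>R e i)"
    using I j a by (simp add: scaleR_add_left sum.distrib)
  then show ?case by (intro exI[of _ "\<lambda>i. (if i = j then c else 0) + a i"])
qed

lemma bracket_span_generated:
  assumes V: "subspace V" and br: "bilinear_map_on V br" and W: "W \<subseteq> V" "subspace W"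
    and central: "\<And>x w. x \<in> V \<Longrightarrow> w \<in> W \<Longrightarrow> br x w = 0 \<and> br w x = 0"
    and e: "e ` {..<q} \<subseteq> V" and gen: "V \<subseteq> span (e ` {..<q} \<union> W)"
  shows "bracket_span br V V \<subseteq> span ((\<lambda>(i, j). br (e i) (e j)) ` ({..<q} \<times> {..<q::nat}))"
proof -
  let ?B = "span ((\<lambda>(i, j). br (e i) (e j)) ` ({..<q} \<times> {..<q}))"
  have dec: "\<exists>a w. x = (\<Sum>i<q. a i *\<^sub>R e i) + w \<and> w \<in> W" if x: "x \<in> V" for x
  proof -
    obtain y w where yw: "x = y + w" "y \<in> span (e ` {..<q})" "w \<in> span W"
      using x gen by (auto simp: span_Un)
    obtain a where "y = (\<Sum>i<q. a i *\<^sub>R e i)"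
      using span_image_combination[OF _ yw(2)] by auto
    moreover have "w \<in> W" using yw(3) W(2) span_minimal[of W W] by blast
    ultimately show ?thesis using yw(1) by blast
  qed
  have "br x y \<in> ?B" if xy: "x \<in> V" "y \<in> V" for x y
  proof -
    obtain a w b w' where x: "x = (\<Sum>i<q. a i *\<^sub>R e i) + w" "w \<in> W" and y: "y = (\<Sum>i<q. b i *\<^sub>R e i) + w'" "w' \<in> W"
      using dec[OF xy(1)] dec[OF xy(2)] by blast
    let ?x = "\<Sum>i<q. a i *\<^sub>R e i" and ?y = "\<Sum>i<q. b i *\<^sub>R e i"
    have s: "?x \<in> V" "?y \<in> V" using e V by (auto intro!: subspace_sum subspace_scale)
    have w: "w \<in> V" "w' \<in> V" using x(2) y(2) W by auto
    have "br x y = br x ?y + br x w'"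
      unfolding y(1) using br xy(1) s w unfolding bilinear_map_on_def linear_map_on_def by blast
    also have "br x w' = 0" using central xy y(2) by blast
    also have "br x ?y = br ?x ?y + br w ?y"
      unfolding x(1) using br s w unfolding bilinear_map_on_def linear_map_on_def by blast
    also have "br w ?y = 0" using central s x(2) by blast
    also have "br ?x ?y = (\<Sum>i<q. \<Sum>j<q. (a i * b j) *\<^sub>R br (e i) (e j))"
      using e by (intro bilinear_map_on_sum[OF V br]) auto
    finally have "br x y = (\<Sum>i<q. \<Sum>j<q. (a i * b j) *\<^sub>R br (e i) (e j))" by simp
    also have "\<dots> \<in> ?B" by (intro span_sum span_scale span_base) auto
    finally show ?thesis .
  qed
  then show ?thesis unfolding bracket_span_def by (intro span_minimal) auto
qed

theorem proposition3:
  fixes V :: "'a::real_vector set" and br :: "'a \<Rightarrow> 'a \<Rightarrow> 'a" and q D :: nat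
  assumes "q \<ge> 3"
    and "D = q * (q - 1) div 2"
    and "lie_algebra V br"
    and "two_step_of_type V br (D - 1) q"
  shows "einstein_nilradical V br"
proof -
  interpret lie_algebra V br by fact
  define W where "W = bracket_span br V V"
  have V: "subspace V" using finite_dimensional by force
  have W: "subspace W" by (simp add: W_def bracket_span_def)
  have brW: "br x y \<in> W" if "x \<in> V" "y \<in> V" for x y
    unfolding W_def bracket_span_def using that by (intro span_base) blast
  have WV: "W \<subseteq> V" unfolding W_def bracket_span_def
    using bracket_closed V by (intro span_minimal) auto
  have dims: "dim V = D - 1 + q" "dim W = D - 1" "bracket_span br V W = {0}"
    using assms(4) by (auto simp: two_step_of_type_def two_step_nilpotent_def W_def)
  have swap: "br x y = - br y x" if "x \<in> V" "y \<in> V" for x y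
    using bilinear_alternating_swap[OF V bracket_bilinear bracket_alternating] that by blast
  have central: "br x w = 0" if "x \<in> V" "w \<in> W" for x w
  proof -
    have "br x w \<in> bracket_span br V W" unfolding bracket_span_def using that by (intro span_base) blast
    then show ?thesis using dims by simp
  qed
  then have central': "br x w = 0 \<and> br w x = 0" if "x \<in> V" "w \<in> W" for x w
    using that swap[of w x] WV by auto
  obtain u where u: "u ` {..<q} \<subseteq> V" "V \<subseteq> span (u ` {..<q} \<union> W)"
    using two_step_generators[OF assms(3,4)] unfolding W_def by blast
  have uV: "u i \<in> V" if "i < q" for i using u(1) that by auto
  define P where "P = Sigma {..<q} (\<lambda>i. {..<i})"
  have D: "card P = D" using assms(2) card_triangle by (simp add: P_def)
  have "D \<ge> 1"
  proof -
    have "(1, 0) \<in> P" using assms(1) by (simp add: P_def)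
    then show ?thesis using D by (metis One_nat_def P_def Suc_leI card_gt_0_iff empty_iff finite_SigmaI finite_lessThan)
  qed
  have "\<exists>c. (\<Sum>t\<in>P. c t *\<^sub>R (case t of (i, j) \<Rightarrow> br (u i) (u j))) = 0 \<and> (\<exists>t\<in>P. c t \<noteq> 0)"
  proof (rule nontrivial_relation)
    show "finite P" by (simp add: P_def)
    have "(\<lambda>(i, j). br (u i) (u j)) ` P \<subseteq> W" using brW uV by (auto simp: P_def)
    then have "dim ((\<lambda>(i, j). br (u i) (u j)) ` P) \<le> dim W"
    proof -
      assume sub: "(\<lambda>(i, j). br (u i) (u j)) ` P \<subseteq> W"
      obtain A where A: "finite A" "span A = V" using finite_dimensional by blast
      obtain B where B: "B \<subseteq> W" "independent B" "W \<subseteq> span B" "card B = dim W"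
        using basis_exists[of W] by blast
      have "finite B" using independent_span_bound[OF A(1) B(2)] A(2) B(1) WV by auto
      then have "dim ((\<lambda>(i, j). br (u i) (u j)) ` P) \<le> card B"
        using sub B(3) by (intro dim_le_card) auto
      then show ?thesis using B(4) by simp
    qed
    then show "dim ((\<lambda>t. case t of (i, j) \<Rightarrow> br (u i) (u j)) ` P) < card P"
      using dims D \<open>D \<ge> 1\<close> by simp
  qed
  then obtain c where c: "(\<Sum>(i, j)\<in>P. c (i, j) *\<^sub>R br (u i) (u j)) = 0" "\<exists>t\<in>P. c t \<noteq> (0::real)"
    by (auto simp: case_prod_beta)
  define C where "C i j = (if j < i then c (i, j) else if i < j then - c (j, i) else 0)" for i j
  have Cskew: "C i j = - C j i" for i j by (simp add: C_def)
  have C0: "(\<Sum>i<q. \<Sum>j<q. C i j *\<^sub>R br (u i) (u j)) = 0"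
  proof -
    let ?h = "\<lambda>i j. if i < q \<and> j < q then C i j *\<^sub>R br (u i) (u j) else 0"
    have "(\<Sum>i<q. \<Sum>j<q. C i j *\<^sub>R br (u i) (u j)) = (\<Sum>i<q. \<Sum>j<q. ?h i j)"
      by (intro sum.cong) auto
    also have "\<dots> = 2 *\<^sub>R (\<Sum>(i, j)\<in>P. ?h i j)"
      unfolding P_def
    proof (rule sum_symmetric_square)
      show "?h i j = ?h j i" for i j using Cskew[of i j] swap[of "u i" "u j"] uV by auto
      show "?h i i = 0" for i by (simp add: C_def)
    qed
    also have "(\<Sum>(i, j)\<in>P. ?h i j) = (\<Sum>(i, j)\<in>P. c (i, j) *\<^sub>R br (u i) (u j))"
      by (intro sum.cong) (auto simp: P_def C_def)
    finally show ?thesis using c by simp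
  qed
  have nz: "\<exists>i\<in>{..<q}. \<exists>j\<in>{..<q}. C i j \<noteq> 0"
  proof -
    obtain i j where "(i, j) \<in> P" "c (i, j) \<noteq> 0" using c(2) by auto
    then show ?thesis by (intro bexI[of _ i] bexI[of _ j]) (auto simp: P_def C_def)
  qed
  have "\<exists>e J S. S \<subseteq> {..<q} \<and> (\<forall>i j. J i j = - J j i) \<and> (\<forall>i j. J i j \<noteq> 0 \<longrightarrow> i \<in> S \<and> j \<in> S) \<and>
    (\<forall>i\<in>S. \<forall>k\<in>S. (\<Sum>j<q. J i j * J k j) = kdelta i k) \<and>
    span (e ` {..<q}) = span (u ` {..<q}) \<and>
    (\<Sum>i<q. \<Sum>j<q. C i j *\<^sub>R br (u i) (u j)) = (\<Sum>i<q. \<Sum>j<q. J i j *\<^sub>R br (e i) (e j)) \<and>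
    ((\<exists>i\<in>{..<q}. \<exists>j\<in>{..<q}. C i j \<noteq> (0::real)) \<longrightarrow> S \<noteq> {})"
    using V bracket_bilinear bracket_alternating finite_lessThan Cskew u(1) by (rule darboux_bivector)
  then obtain e J S where J: "S \<subseteq> {..<q}" "\<forall>i j. J i j = - J j i"
      "\<forall>i j. J i j \<noteq> 0 \<longrightarrow> i \<in> S \<and> j \<in> S" "\<forall>i\<in>S. \<forall>k\<in>S. (\<Sum>j<q. J i j * J k j) = kdelta i k"
      and e: "span (e ` {..<q}) = span (u ` {..<q})"
      and CJ: "(\<Sum>i<q. \<Sum>j<q. C i j *\<^sub>R br (u i) (u j)) = (\<Sum>i<q. \<Sum>j<q. J i j *\<^sub>R br (e i) (e j))"
      and ne: "(\<exists>i\<in>{..<q}. \<exists>j\<in>{..<q}. C i j \<noteq> 0) \<longrightarrow> S \<noteq> {}"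
    by (elim exE conjE) (rule that; assumption)
  have rel: "(\<Sum>i<q. \<Sum>j<q. J i j *\<^sub>R br (e i) (e j)) = 0" using CJ C0 by (rule trans[OF sym])
  have S: "S \<noteq> {}" using ne nz by (rule mp)
  interpret bivector q J S
    by unfold_locales (use J S in blast)+
  obtain d a where "soliton q J S d a" using soliton_exists[OF assms(1)] .
  then interpret s: soliton q J S d a .
  have eV: "e ` {..<q} \<subseteq> V"
  proof -
    have "span (u ` {..<q}) \<subseteq> V" using u(1) V by (rule span_minimal)
    then show ?thesis using span_superset[of "e ` {..<q}"] e by simp
  qed
  have gen: "V \<subseteq> span (e ` {..<q} \<union> W)"
    using u(2) by (simp add: span_Un e)
  have "W \<subseteq> span ((\<lambda>(i, j). br (e i) (e j)) ` ({..<q} \<times> {..<q}))"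
    unfolding W_def using bracket_span_generated[OF V bracket_bilinear WV W central' eV gen] .
  then have gen': "V \<subseteq> span (e ` {..<q} \<union> (\<lambda>(i, j). br (e i) (e j)) ` ({..<q} \<times> {..<q}))"
  proof -
    assume sub: "W \<subseteq> span ((\<lambda>(i, j). br (e i) (e j)) ` ({..<q} \<times> {..<q}))"
    let ?S = "span (e ` {..<q} \<union> (\<lambda>(i, j). br (e i) (e j)) ` ({..<q} \<times> {..<q}))"
    have "W \<subseteq> ?S" using sub span_mono[OF Un_upper2] by (rule order_trans)
    moreover have "e ` {..<q} \<subseteq> ?S" by (rule order_trans[OF Un_upper1 span_superset])
    ultimately have "span (e ` {..<q} \<union> W) \<subseteq> ?S" by (intro span_minimal) auto
    then show ?thesis using gen by blast
  qed
  have "lie_isomorphic V br s.N s.brG"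
  proof (rule s.lie_isomorphic_N[OF V bracket_bilinear bracket_alternating bracket_closed W WV brW central _ gen' _ rel])
    show "e i \<in> V" if "i < q" for i using eV that by auto
    show "dim V = q + (q * (q - 1) div 2 - 1)" using dims assms(2) by simp
  qed
  then show ?thesis
    unfolding einstein_nilradical_def using s.einstein_G s.nilradical_N by blast
qed

end
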